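(* Let $d\in\mathbb{Q}$, $\ell\in\mathbb{N}$, $z\in\mathbb{C}$, and write $z=(z_0+j)/\ell$ with $j\in\mathbb{Z}$, $z_0=x_0+iy_0$, $x_0,y_0\in\mathbb{R}$, $-1/2<x_0\le1/2$. As $t\to0^+$, for every $N\in\mathbb{N}_0$: (i) If $\operatorname{Im}(z)>0$, or ($\operatorname{Im}(z)<0$ and $|x_0|>|y_0|$), or $z\in\mathbb{R}\setminus\frac1\ell\mathbb{Z}$, then $$G_{d,\ell}(z;it)=2i\sum_{a=0}^N\mathcal{D}_z^{2a}\left(\frac{\sin(2\pi dz)}{1-\zeta^\ell}\right)\frac{(-2\pi t)^a}{a!}+O\left(t^{N+1}\right).$$ (ii) If $\operatorname{Im}(z)<0$ and $|x_0|\le|y_0|$, then $$G_{d,\ell}(z;it)=2i\left(2\ell^2t\right)^{-\frac12}e^{-\frac{\pi z_0^2}{2\ell^2t}}\sum_{\substack{n\in\mathbb{Z}\\|n+x_0|\le|y_0|}}e^{-\frac{\pi n^2}{2\ell^2t}-\frac{\pi z_0n}{\ell^2t}}\sin\left(\frac{2\pi d}{\ell}(j-n)\right)+2i\sum_{a=0}^N\mathcal{D}_z^{2a}\left(\frac{\sin(2\pi dz)}{1-\zeta^\ell}\right)\frac{(-2\pi t)^a}{a!}+O\left(t^{N+1}\right).$$ (iii) If $z\in\frac1\ell\mathbb{Z}$, then $$G_{d,\ell}(z;it)=\frac{i\sin(2\pi dz)}{\ell(2t)^{1/2}}-\sum_{a=0}^N\left(\zeta^dB_{2a+1}\left(\frac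 d\ell\right)-\zeta^{-d}B_{2a+1}\left(-\frac d\ell\right)\right)\frac{\left(-2\pi\ell^2t\right)^a}{a!(2a+1)}+O\left(t^{N+1}\right).$$
   Context: For $z\in\mathbb{C}$, $\tau$ in the upper half-plane, $\zeta^x:=e^{2\pi ixz}$, $q^x:=e^{2\pi ix\tau}$ ($x\in\mathbb{Q}$). $F_{d,\ell}(z;\tau):=\sum_{n\ge0}\zeta^{\ell n+d}q^{(\ell n+d)^2}$ and $G_{d,\ell}(z;\tau):=F_{d,\ell}(z;\tau)-F_{-d,\ell}(z;\tau)$. $\mathcal{D}_z:=\frac1{2\pi i}\frac{\partial}{\partial z}$; $B_n$ are Bernoulli polynomials. Powers of positive reals are positive. *)

theory Defs
  imports "HOL-Complex_Analysis.Complex_Analysis" "HOL-Library.Landau_Symbols"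
begin

text \<open>
  The common form of the powers of \<open>\<zeta>\<close> and \<open>q\<close>: \<open>\<zeta>\<^sup>x\<close> is \<open>epow x z\<close> and \<open>q\<^sup>x\<close> is \<open>epow x \<tau>\<close>.
\<close>

definition epow :: "rat \<Rightarrow> complex \<Rightarrow> complex" where
  "epow x w = exp (2 * of_real pi * \<i> * of_rat x * w)"

text \<open>The series converges absolutely for \<open>Im \<tau> > 0\<close>, the only case in which it is meaningful.\<close>

definition F :: "rat \<Rightarrow> nat \<Rightarrow> complex \<Rightarrow> complex \<Rightarrow> complex" where
  "F d l z \<tau> = (\<Sum>n. epow (of_nat l * of_nat n + d) z * epow ((of_nat l * of_nat n + d)\<^sup>2) \<tau>)"

definition G :: "rat \<Rightarrow> nat \<Rightarrow> complex \<Rightarrow> complex \<Rightarrow> complex" where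
  "G d l z \<tau> = F d l z \<tau> - F (- d) l z \<tau>"

definition Dz :: "(complex \<Rightarrow> complex) \<Rightarrow> complex \<Rightarrow> complex" where
  "Dz f = (\<lambda>z. 1 / (2 * of_real pi * \<i>) * deriv f z)"

text \<open>
  Bernoulli polynomials, as coefficients of the generating function
  \<open>X e\<^bsup>xX\<^esup> / (e\<^sup>X - 1) = (\<Sum>n. B\<^sub>n(x) X\<^sup>n / n!)\<close>; the quotient of formal power series is exact,
  as both \<open>X\<close> and \<open>e\<^sup>X - 1\<close> have subdegree 1.
\<close>

definition bernoulli_poly :: "nat \<Rightarrow> complex \<Rightarrow> complex" where
  "bernoulli_poly n x = fact n * fps_nth (fps_X * fps_exp x / (fps_exp 1 - 1)) n"

lemma bernoulli_poly_genfun: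
  "Abs_fps (\<lambda>n. bernoulli_poly n x / fact n) * (fps_exp 1 - 1) = fps_X * fps_exp x"
proof -
  have eq: "Abs_fps (\<lambda>n. bernoulli_poly n x / fact n) = fps_X * fps_exp x / (fps_exp 1 - 1)"
    by (simp add: bernoulli_poly_def fps_eq_iff)
  have sub: "subdegree (fps_exp 1 - 1 :: complex fps) = 1"
    by (rule subdegreeI) auto
  have ne: "fps_exp 1 - 1 \<noteq> (0 :: complex fps)"
    using sub by auto
  have "(fps_exp 1 - 1 :: complex fps) dvd fps_X * fps_exp x"
    using sub ne by (subst fps_dvd_iff) auto
  thus ?thesis
    unfolding eq by simp
qed

text \<open>The set \<open>(1/l) \<int>\<close>, as a subset of the complex numbers.\<close>

definition frac_ints :: "nat \<Rightarrow> complex set" where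
  "frac_ints l = {of_int m / of_nat l | m. True}"

end

theory Submission
  imports Defs "HOL-Probability.Probability" "HOL-Real_Asymp.Real_Asymp"
begin

text \<open>
  Up to the factor \<open>\<zeta>\<^sup>d\<close>, \<open>F d l z (\<i> t)\<close> is \<open>S(w, a, s) = (\<Sum>n. w\<^sup>n e\<^bsup>-s(n + a)\<^sup>2\<^esup>)\<close> with
  \<open>w = \<zeta>\<^sup>l\<close>, \<open>a = d/l\<close>, \<open>s = 2\<pi>l\<^sup>2t\<close>. For \<open>|w| \<le> 1\<close> the expansion of \<open>S\<close> comes from Euler--Maclaurin
  summation twisted by \<open>w\<close>: if \<open>b(X) = X e\<^bsup>aX\<^esup> / (1 - w e\<^sup>X)\<close>, then \<open>\<Sum>k. b\<^sub>k \<phi>\<^sup>(\<^sup>k\<^sup>-\<^sup>1\<^sup>)\<close> with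
  \<open>\<phi>(x) = e\<^bsup>-sx\<^sup>2\<^esup>\<close> telescopes the sum up to Taylor remainders. The coefficients of \<open>b\<close> are Bernoulli
  polynomials for \<open>w = 1\<close> and derivatives of the sine quotient otherwise. For \<open>|w| > 1\<close> the terms with
  \<open>n < 0\<close> form a sum of the same kind for \<open>1/w\<close>, with the same expansion up to sign, so \<open>S\<close> is that
  expansion plus the full theta series. Poisson summation turns the latter into a sum of
  \<open>e\<^bsup>-\<pi>(z\<^sub>0 + n)\<^sup>2 / 2l\<^sup>2t\<^esup>\<close>, which is negligible unless \<open>Re ((z\<^sub>0 + n)\<^sup>2) \<le> 0\<close>, that is
  \<open>|n + x\<^sub>0| \<le> |y\<^sub>0|\<close>.
\<close>

section \<open>Euler--Maclaurin summation of shifted Gaussians\<close>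

text \<open>The twist w^n must stay bounded for the Taylor remainders to be summable, so the direct
  argument stops at |w| = 1; this forces the detour through 1/w when Im z < 0. The detour closes
  because w b(-X) is the generating function belonging to 1/w and 1 - a, and because only odd
  coefficients of b meet nonzero derivatives of the Gaussian at 0: the reflected half reproduces the
  expansion with the opposite sign. The one even coefficient that can matter is b_0, attached to the
  primitive of the Gaussian; it vanishes for w \<noteq> 1 and produces the t^(-1/2) term of (iii)
  for w = 1. In (ii) the boundary case Re ((z_0 + n)^2) = 0 has to be kept, since such an
  exponential has modulus 1 and is absorbed by no power of t. The condition |x_0| > |y_0| in (i)
  makes the finite sum of (ii) empty, so both cases share one proof. Taking the difference over d
  and -d turns the phases of the dual terms into sines.\<close>

fun gauss_deriv :: "nat \<Rightarrow> real \<Rightarrow> real" where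
  "gauss_deriv 0 x = exp (- x\<^sup>2)"
| "gauss_deriv (Suc 0) x = - 2 * x * exp (- x\<^sup>2)"
| "gauss_deriv (Suc (Suc m)) x =
     - 2 * x * gauss_deriv (Suc m) x - 2 * real (Suc m) * gauss_deriv m x"

text \<open>\<open>gauss_deriv m\<close> is (-1)^m H_m(x) e^(-x^2) with the physicists' Hermite
  polynomial H_m, and its recursion is the three-term recurrence of H_m. Once it is identified with
  iterated differentiation, values at 0 and decay follow by inductions on the recursion.\<close>

lemma gauss_deriv_has_derivative:
  "(gauss_deriv m has_real_derivative gauss_deriv (Suc m) x) (at x)"
proof (induction m arbitrary: x rule: induct_nat_012)
  case 0
  have "gauss_deriv 0 = (\<lambda>x. exp (- x\<^sup>2))" by auto
  thus ?case by (auto intro!: derivative_eq_intros)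
next
  case 1
  have "gauss_deriv (Suc 0) = (\<lambda>x. - 2 * x * exp (- x\<^sup>2))" by auto
  thus ?case by (auto intro!: derivative_eq_intros simp: power2_eq_square algebra_simps)
next
  case (ge2 n)
  have "gauss_deriv (Suc (Suc n)) =
      (\<lambda>x. - 2 * x * gauss_deriv (Suc n) x - 2 * real (Suc n) * gauss_deriv n x)"
    by auto
  thus ?case
    by (auto intro!: derivative_eq_intros ge2 simp: algebra_simps)
qed

text \<open>Odd derivatives of an even function vanish at 0; this is what removes the coefficients
  b_2, b_4, ... of the generating series from every expansion below.\<close>

lemma gauss_deriv_odd_0: "gauss_deriv (2 * k + 1) 0 = 0"
  by (induction k) auto

lemma gauss_deriv_even_0: "gauss_deriv (2 * k) 0 = (- 1) ^ k * fact (2 * k) / fact k"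
proof (induction k)
  case (Suc k)
  have "gauss_deriv (2 * Suc k) 0 = - 2 * real (2 * k + 1) * ((- 1) ^ k * fact (2 * k) / fact k)"
    unfolding Suc[symmetric] by (simp add: algebra_simps)
  also have "\<dots> = (- 1) ^ Suc k * (2 * (real k + 1) * (2 * real k + 1) * fact (2 * k)) / ((real k + 1) * fact k)"
    by (simp add: divide_simps) (simp add: algebra_simps)
  also have "\<dots> = (- 1) ^ Suc k * fact (2 * Suc k) / fact (Suc k)"
    by (simp add: algebra_simps)
  finally show ?case .
qed auto

lemma power_le_fact_exp:
  fixes x :: real
  assumes "x \<ge> 0"
  shows "x ^ k \<le> fact k * exp x"
proof -
  have "x ^ k /\<^sub>R fact k \<le> (\<Sum>n. x ^ n /\<^sub>R fact n)"
    using sum_le_suminf[of "\<lambda>n. x ^ n /\<^sub>R fact n" "{k}"] assms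
    by (simp add: summable_exp)
  thus ?thesis by (simp add: exp_def field_simps)
qed

text \<open>The power of x is left arbitrary in the induction because the recursion multiplies by x:
  order n + 2 at weight k calls on order n + 1 at weight k + 1.\<close>

lemma gauss_deriv_times_power_bounded: "\<exists>C. \<forall>x. \<bar>x ^ k * gauss_deriv m x\<bar> \<le> C"
proof -
  \<comment> \<open>Comparing x^k with 1 + (x^2)^k leaves an even power, which
    \<open>power_le_fact_exp\<close> at x^2 weighs directly against the Gaussian.\<close>
  have base: "\<bar>x ^ k * exp (- x\<^sup>2)\<bar> \<le> 1 + fact k" for k and x :: real
  proof -
    have "\<bar>x ^ k\<bar> \<le> 1 + (x\<^sup>2) ^ k"
    proof (cases "\<bar>x\<bar> \<le> 1")
      case True
      hence "\<bar>x\<bar> ^ k \<le> 1" by (intro power_le_one) auto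
      thus ?thesis by (simp add: power_abs add_increasing2)
    next
      case False
      hence "\<bar>x\<bar> ^ k \<le> \<bar>x\<bar> ^ (2 * k)" by (intro power_increasing) auto
      thus ?thesis by (simp add: power_abs power_even_abs flip: power_mult)
    qed
    moreover have "(x\<^sup>2) ^ k \<le> fact k * exp (x\<^sup>2)"
      by (intro power_le_fact_exp) auto
    moreover have "1 \<le> exp (x\<^sup>2)" by (subst one_le_exp_iff) simp
    ultimately have "\<bar>x ^ k\<bar> \<le> exp (x\<^sup>2) + fact k * exp (x\<^sup>2)" by linarith
    hence "\<bar>x ^ k\<bar> \<le> (1 + fact k) * exp (x\<^sup>2)" by (simp only: distrib_right mult_1)
    hence "\<bar>x ^ k\<bar> * exp (- x\<^sup>2) \<le> (1 + fact k)"
      by (simp add: exp_minus field_simps)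
    thus ?thesis by (simp add: abs_mult)
  qed
  show ?thesis
  proof (induction m arbitrary: k rule: induct_nat_012)
    case 0
    show ?case using base[of _ k] by auto
  next
    case 1
    have "\<bar>x ^ k * gauss_deriv (Suc 0) x\<bar> \<le> 2 * (1 + fact (Suc k))" for x
    proof -
      have "x ^ k * gauss_deriv (Suc 0) x = - 2 * (x ^ Suc k * exp (- x\<^sup>2))" by simp
      thus ?thesis using base[of x "Suc k"] by (simp only: abs_mult) simp
    qed
    thus ?case by blast
  next
    case (ge2 n)
    obtain C1 where C1: "\<And>x. \<bar>x ^ k * gauss_deriv n x\<bar> \<le> C1" using ge2(1) by blast
    obtain C2 where C2: "\<And>x. \<bar>x ^ Suc k * gauss_deriv (Suc n) x\<bar> \<le> C2" using ge2(2) by blast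
    have "\<bar>x ^ k * gauss_deriv (Suc (Suc n)) x\<bar> \<le> 2 * C2 + 2 * real (Suc n) * C1" for x
    proof -
      have "x ^ k * gauss_deriv (Suc (Suc n)) x =
          - 2 * (x ^ Suc k * gauss_deriv (Suc n) x) - 2 * real (Suc n) * (x ^ k * gauss_deriv n x)"
        by (simp add: algebra_simps)
      hence "\<bar>x ^ k * gauss_deriv (Suc (Suc n)) x\<bar> \<le>
          \<bar>2 * (x ^ Suc k * gauss_deriv (Suc n) x)\<bar> + \<bar>2 * real (Suc n) * (x ^ k * gauss_deriv n x)\<bar>"
        by linarith
      also have "\<dots> = 2 * \<bar>x ^ Suc k * gauss_deriv (Suc n) x\<bar>
            + 2 * real (Suc n) * \<bar>x ^ k * gauss_deriv n x\<bar>"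
        by (simp only: abs_mult) simp
      also have "\<dots> \<le> 2 * C2 + 2 * real (Suc n) * C1"
        by (intro add_mono mult_left_mono C1 C2) auto
      finally show ?thesis .
    qed
    thus ?case by blast
  qed
qed

text \<open>Only a decay summable over the integers is wanted; the quadratic one limits the later
  loss under scaling to r^(-2).\<close>

lemma gauss_deriv_decay:
  obtains C where "C > 0" "\<And>x. \<bar>gauss_deriv m x\<bar> \<le> C / (1 + x\<^sup>2)"
proof -
  obtain C1 where C1: "\<And>x. \<bar>x ^ 0 * gauss_deriv m x\<bar> \<le> C1"
    using gauss_deriv_times_power_bounded by blast
  obtain C2 where C2: "\<And>x. \<bar>x ^ 2 * gauss_deriv m x\<bar> \<le> C2"
    using gauss_deriv_times_power_bounded by blast
  have "\<bar>gauss_deriv m x\<bar> \<le> (\<bar>C1\<bar> + \<bar>C2\<bar> + 1) / (1 + x\<^sup>2)" for x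
  proof -
    have "\<bar>gauss_deriv m x\<bar> * (1 + x\<^sup>2) = \<bar>x ^ 0 * gauss_deriv m x\<bar> + \<bar>x ^ 2 * gauss_deriv m x\<bar>"
      by (simp add: abs_mult algebra_simps)
    also have "\<dots> \<le> \<bar>C1\<bar> + \<bar>C2\<bar> + 1" using C1[of x] C2[of x] by linarith
    finally show ?thesis
      by (subst pos_le_divide_eq) (auto simp: add_pos_nonneg)
  qed
  thus ?thesis by (intro that[of "\<bar>C1\<bar> + \<bar>C2\<bar> + 1"]) auto
qed

text \<open>The constant is the integral of the Gaussian over the positive half-line, so this
  primitive vanishes at +infinity, as telescoping requires. For negative x the interval is empty and
  the function constant; it is a primitive only on x \<ge> 0, which is why its derivatives are taken
  within that half-line.\<close>

definition gauss_prim :: "real \<Rightarrow> real" where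
  "gauss_prim x = integral {0..x} (\<lambda>u. exp (- u\<^sup>2)) - sqrt pi / 2"

lemma gauss_prim_0: "gauss_prim 0 = - sqrt pi / 2"
  by (simp add: gauss_prim_def)

lemma gauss_prim_has_derivative:
  assumes "x \<ge> 0"
  shows "(gauss_prim has_real_derivative gauss_deriv 0 x) (at x within {0..})"
proof -
  have "((\<lambda>x. integral {0..x} (\<lambda>u. exp (- u\<^sup>2))) has_real_derivative exp (- x\<^sup>2))
      (at x within {0..x+1})"
    using assms by (intro integral_has_real_derivative continuous_intros) auto
  hence "(gauss_prim has_real_derivative exp (- x\<^sup>2)) (at x within {0..x+1})"
    unfolding gauss_prim_def by (auto intro!: derivative_eq_intros)
  moreover have "at x within {0..x+1} = at x within {0..}"
  proof -
    have "{0..x+1} \<inter> {..<x+1} - {x} = {0..} \<inter> {..<x+1} - {x}" by auto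
    thus ?thesis by (intro at_within_nhd[of _ "{..<x+1}"]) auto
  qed
  ultimately show ?thesis by simp
qed

lemma gauss_prim_tendsto_0: "(gauss_prim \<longlongrightarrow> 0) at_top"
proof -
  let ?f = "\<lambda>x::real. indicator {0..} x *\<^sub>R exp (- x\<^sup>2)"
  have "((\<lambda>y. \<integral> x. indicator {.. y} x *\<^sub>R ?f x \<partial>lborel) \<longlongrightarrow> (\<integral> x. ?f x \<partial>lborel)) at_top"
    using gaussian_moment_0 by (intro tendsto_integral_at_top) (auto simp: has_bochner_integral_iff)
  also have "(\<integral> x. ?f x \<partial>lborel) = sqrt pi / 2"
    using gaussian_moment_0 by (simp add: has_bochner_integral_iff)
  also have "(\<lambda>y. \<integral> x. indicator {.. y} x *\<^sub>R ?f x \<partial>lborel)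
      = (\<lambda>y. integral {0..y} (\<lambda>u. exp (- u\<^sup>2)))"
  proof
    fix y :: real
    have "(\<integral> x. indicator {.. y} x *\<^sub>R ?f x \<partial>lborel) = (LINT x:{0..y}|lborel. exp (- x\<^sup>2))"
      unfolding set_lebesgue_integral_def
      by (intro Bochner_Integration.integral_cong) (auto simp: indicator_def)
    also have "\<dots> = integral {0..y} (\<lambda>u. exp (- u\<^sup>2))"
      by (intro set_borel_integral_eq_integral borel_integrable_atLeastAtMost') (auto intro!: continuous_intros)
    finally show "(\<integral> x. indicator {.. y} x *\<^sub>R ?f x \<partial>lborel) = integral {0..y} (\<lambda>u. exp (- u\<^sup>2))" .
  qed
  finally show ?thesis
    unfolding gauss_prim_def using tendsto_diff[OF _ tendsto_const[of "sqrt pi / 2"]] by fastforce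
qed

text \<open>With X read as differentiation, e^X is the shift by 1. Entry k is expanded only to order
  K - k, so no derivative beyond K occurs and the double sum is a full triangle, which can be
  regrouped by total order.\<close>

lemma sum_fps_mult_exp_taylor:
  fixes b :: "complex fps" and \<phi> :: "nat \<Rightarrow> complex"
  shows "(\<Sum>k\<le>K. fps_nth b k * (\<Sum>j\<le>K-k. \<phi> (k + j) / fact j))
       = (\<Sum>i\<le>K. fps_nth (b * fps_exp 1) i * \<phi> i)"
proof -
  have "(\<Sum>i\<le>K. fps_nth (b * fps_exp 1) i * \<phi> i)
      = (\<Sum>i\<le>K. \<Sum>k\<le>i. fps_nth b k * \<phi> (k + (i - k)) / fact (i - k))"
    by (simp add: fps_mult_nth atLeast0AtMost sum_distrib_right)
  also have "\<dots> = (\<Sum>k\<le>K. \<Sum>j\<le>K-k. fps_nth b k * \<phi> (k + j) / fact j)"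
    unfolding sum.triangle_reindex_eq[of "\<lambda>k j. fps_nth b k * \<phi> (k + j) / fact j" K, symmetric]
    by (subst sum.Sigma) (auto intro!: sum.cong)
  finally show ?thesis by (simp add: sum_distrib_left)
qed

text \<open>The order K - m depends on the starting derivative, so that every remainder is governed
  by the same derivative K + 1.\<close>

lemma taylor_step:
  fixes \<phi> :: "nat \<Rightarrow> real \<Rightarrow> real"
  assumes deriv: "\<And>k x. k \<ge> m \<Longrightarrow> k \<le> K \<Longrightarrow> x \<in> S \<Longrightarrow> (\<phi> k has_real_derivative \<phi> (Suc k) x) (at x within S)"
    and S: "convex S" "u \<in> S" "u + h \<in> S" and mK: "m \<le> K"
    and D: "\<And>x. x \<in> S \<Longrightarrow> \<bar>\<phi> (Suc K) x\<bar> \<le> D"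
  shows "\<bar>\<phi> m (u + h) - (\<Sum>j\<le>K-m. \<phi> (m + j) u * h ^ j / fact j)\<bar> \<le> D * \<bar>h\<bar> ^ Suc (K - m)"
proof -
  have D0: "D \<ge> 0" using D[OF S(2)] by linarith
  have "norm (\<phi> (m + 0) (u + h) - (\<Sum>j\<le>K-m. \<phi> (m + j) u * (u + h - u) ^ j / fact j))
      \<le> D * norm (u + h - u) ^ Suc (K - m) / fact (K - m)"
    using assms by (intro field_Taylor[where f = "\<lambda>i. \<phi> (m + i)" and S = S]) auto
  also have "\<dots> \<le> D * norm (u + h - u) ^ Suc (K - m) / 1"
    using D0 by (intro divide_left_mono) auto
  finally show ?thesis by simp
qed

text \<open>The relation \<open>b \<cdot> (1 - w e\<^sup>X) = X e\<^bsup>aX\<^esup>\<close> says that \<open>H(x) - w H(x + 1) = \<phi>\<^sub>1(x + a)\<close> for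
  the formal antidifference \<open>H = \<Sum>k. b\<^sub>k \<phi>\<^sub>k\<close>, since \<open>X\<close> stands for differentiation.\<close>

lemma antidifference_error:
  fixes b :: "complex fps" and w :: complex and a :: real and K :: nat
  assumes b: "b * (1 - fps_const w * fps_exp 1) = fps_X * fps_exp (of_real a)"
    and w: "norm w \<le> 1" and K: "K \<ge> 1"
  obtains A where "A > 0"
    "\<And>\<phi> u D. (\<And>x. x \<ge> 0 \<Longrightarrow> (\<phi> 0 has_real_derivative \<phi> 1 x) (at x within {0..})) \<Longrightarrow>
       (\<And>k x. k \<ge> 1 \<Longrightarrow> (\<phi> k has_real_derivative \<phi> (Suc k) x) (at x)) \<Longrightarrow>
       u \<ge> 0 \<Longrightarrow> (\<And>x. \<bar>x - u\<bar> \<le> \<bar>a\<bar> + 1 \<Longrightarrow> \<bar>\<phi> (Suc K) x\<bar> \<le> D) \<Longrightarrow>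
       norm (of_real (\<phi> 1 (u + a)) - ((\<Sum>k\<le>K. fps_nth b k * of_real (\<phi> k u))
          - w * (\<Sum>k\<le>K. fps_nth b k * of_real (\<phi> k (u + 1))))) \<le> A * D"
proof (rule that)
  define B where "B = (\<Sum>k\<le>K. norm (fps_nth b k))"
  have B0: "B \<ge> 0" by (simp add: B_def sum_nonneg)
  thus "\<bar>a\<bar> ^ K + B + 1 > 0" by (simp add: add_nonneg_pos)
  fix \<phi> :: "nat \<Rightarrow> real \<Rightarrow> real" and u D :: real
  assume d0: "\<And>x. x \<ge> 0 \<Longrightarrow> (\<phi> 0 has_real_derivative \<phi> 1 x) (at x within {0..})"
    and d1: "\<And>k x. k \<ge> 1 \<Longrightarrow> (\<phi> k has_real_derivative \<phi> (Suc k) x) (at x)"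
    and u: "u \<ge> 0"
    and D: "\<And>x. \<bar>x - u\<bar> \<le> \<bar>a\<bar> + 1 \<Longrightarrow> \<bar>\<phi> (Suc K) x\<bar> \<le> D"
  have D0: "D \<ge> 0" using D[of u] by auto
  define R where "R = (\<lambda>k. \<phi> k (u + 1) - (\<Sum>j\<le>K-k. \<phi> (k + j) u / fact j))"
  define R' where "R' = \<phi> 1 (u + a) - (\<Sum>j\<le>K-1. \<phi> (1 + j) u * a ^ j / fact j)"
  \<comment> \<open>The unit step runs to the right of u \<ge> 0, so it stays where the one-sided
    derivative of \<open>\<phi> 0\<close> is available.\<close>
  have R: "\<bar>R k\<bar> \<le> D" if "k \<le> K" for k
  proof -
    have "(\<phi> k has_real_derivative \<phi> (Suc k) x) (at x within {u..u+1})" if "x \<in> {u..u+1}" for k x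
    proof (cases "k = 0")
      case True
      thus ?thesis using d0[of x] that u
        by (auto intro: has_field_derivative_subset[of _ _ _ "{0..}"])
    next
      case False
      thus ?thesis using d1[of k x] by (auto intro: has_field_derivative_at_within)
    qed
    hence "\<bar>\<phi> k (u + 1) - (\<Sum>j\<le>K-k. \<phi> (k + j) u * 1 ^ j / fact j)\<bar> \<le> D * \<bar>1\<bar> ^ Suc (K - k)"
      by (intro taylor_step[where S = "{u..u+1}"]) (use that D in auto)
    thus ?thesis by (simp add: R_def)
  qed
  \<comment> \<open>The step a may be negative and leave the half-line; this expansion starts at
    \<open>\<phi> 1\<close>, whose derivatives exist on the whole line.\<close>
  have "\<bar>R'\<bar> \<le> D * \<bar>a\<bar> ^ Suc (K - 1)"
    unfolding R'_def
    by (intro taylor_step[where S = "{u-\<bar>a\<bar>..u+\<bar>a\<bar>}"])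
       (use K D in \<open>auto intro!: has_field_derivative_at_within d1\<close>)
  hence R': "\<bar>R'\<bar> \<le> D * \<bar>a\<bar> ^ K" using K by simp

  define \<psi> where "\<psi> = (\<lambda>k. complex_of_real (\<phi> k u))"
  have shifted: "(\<Sum>k\<le>K. fps_nth b k * of_real (\<phi> k (u + 1)))
      = (\<Sum>i\<le>K. fps_nth (b * fps_exp 1) i * \<psi> i) + (\<Sum>k\<le>K. fps_nth b k * of_real (R k))"
    unfolding sum_fps_mult_exp_taylor[symmetric] sum.distrib[symmetric]
    by (intro sum.cong) (auto simp: R_def \<psi>_def algebra_simps)
  have nth: "fps_nth b i - w * fps_nth (b * fps_exp 1) i = fps_nth (fps_X * fps_exp (of_real a)) i" for i
  proof -
    have "fps_nth (b * (1 - fps_const w * fps_exp 1)) i = fps_nth b i - w * fps_nth (b * fps_exp 1) i"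
      by (simp add: algebra_simps)
         (metis (no_types, lifting) fps_mult_left_const_nth mult.left_commute)
    thus ?thesis using b by simp
  qed
  \<comment> \<open>The defining relation of b collapses both sums to the Taylor polynomial of
    \<open>\<phi> 1\<close> about u with step a; the factor X accounts for the shift of the
    index.\<close>
  have "(\<Sum>i\<le>K. fps_nth b i * \<psi> i) - w * (\<Sum>i\<le>K. fps_nth (b * fps_exp 1) i * \<psi> i)
      = (\<Sum>i\<le>K. fps_nth (fps_X * fps_exp (of_real a)) i * \<psi> i)"
    unfolding nth[symmetric] by (simp add: sum_distrib_left sum_subtractf algebra_simps)
  also have "\<dots> = (\<Sum>i\<le>Suc (K - 1). fps_nth (fps_X * fps_exp (of_real a)) i * \<psi> i)"
    using K by simp
  also have "\<dots> = (\<Sum>j\<le>K-1. of_real a ^ j / fact j * \<psi> (Suc j))"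
    by (subst sum.atMost_Suc_shift) simp
  also have "\<dots> = of_real (\<phi> 1 (u + a) - R')"
    by (simp add: R'_def \<psi>_def mult_ac)
  finally have "of_real (\<phi> 1 (u + a)) - ((\<Sum>k\<le>K. fps_nth b k * \<psi> k)
      - w * (\<Sum>k\<le>K. fps_nth b k * of_real (\<phi> k (u + 1))))
      = of_real R' + w * (\<Sum>k\<le>K. fps_nth b k * of_real (R k))"
    unfolding shifted by (simp add: algebra_simps)
  also have "norm \<dots> \<le> norm (complex_of_real R') + norm w * norm (\<Sum>k\<le>K. fps_nth b k * of_real (R k))"
    by (rule order_trans[OF norm_triangle_ineq]) (simp add: norm_mult)
  also have "\<dots> \<le> D * \<bar>a\<bar> ^ K + 1 * (D * B)"
  proof (intro add_mono mult_mono w)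
    have "norm (\<Sum>k\<le>K. fps_nth b k * of_real (R k)) \<le> (\<Sum>k\<le>K. norm (fps_nth b k) * D)"
      by (intro sum_norm_le) (auto simp: norm_mult intro!: mult_left_mono R)
    thus "norm (\<Sum>k\<le>K. fps_nth b k * of_real (R k)) \<le> D * B"
      by (simp add: B_def sum_distrib_left mult_ac)
  qed (use R' in auto)
  also have "\<dots> \<le> (\<bar>a\<bar> ^ K + B + 1) * D" using D0 by (simp add: algebra_simps)
  finally show "norm (of_real (\<phi> 1 (u + a)) - ((\<Sum>k\<le>K. fps_nth b k * of_real (\<phi> k u))
          - w * (\<Sum>k\<le>K. fps_nth b k * of_real (\<phi> k (u + 1))))) \<le> (\<bar>a\<bar> ^ K + B + 1) * D"
    by (simp add: \<psi>_def)
qed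

text \<open>Trades the evaluation point x of a Taylor remainder for the summation index u. As r
  \<le> 1, r^2 (1 + x^2) \<le> 1 + (r x)^2, which costs r^(-2); the distance is paid for through u^2
  \<le> 2 x^2 + 2 (x - u)^2.\<close>

lemma inverse_one_plus_square_near:
  fixes r x u c :: real
  assumes r: "0 < r" "r \<le> 1" and x: "\<bar>x - u\<bar> \<le> c"
  shows "1 / (1 + (r * x)\<^sup>2) \<le> 2 * (1 + c\<^sup>2) / (r\<^sup>2 * (1 + u\<^sup>2))"
proof -
  have "u\<^sup>2 \<le> 2 * x\<^sup>2 + 2 * (x - u)\<^sup>2"
    using sum_squares_ge_zero[of "2 * x - u" 0] by (simp add: power2_eq_square algebra_simps)
  also have "(x - u)\<^sup>2 \<le> c\<^sup>2" using x by (metis abs_le_square_iff abs_of_nonneg abs_ge_zero order_trans)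
  finally have "1 + u\<^sup>2 \<le> 2 * (1 + c\<^sup>2) * (1 + x\<^sup>2)"
    by (simp add: algebra_simps) (smt (verit) mult_nonneg_nonneg zero_le_power2)
  hence "r\<^sup>2 * (1 + u\<^sup>2) \<le> r\<^sup>2 * (2 * (1 + c\<^sup>2) * (1 + x\<^sup>2))"
    by (intro mult_left_mono) auto
  also have "\<dots> = 2 * (1 + c\<^sup>2) * (r\<^sup>2 + (r * x)\<^sup>2)" by (simp add: power_mult_distrib algebra_simps)
  also have "\<dots> \<le> 2 * (1 + c\<^sup>2) * (1 + (r * x)\<^sup>2)"
    using r by (intro mult_left_mono add_right_mono) (auto simp: power_le_one)
  finally have "r\<^sup>2 * (1 + u\<^sup>2) \<le> 2 * (1 + c\<^sup>2) * (1 + (r * x)\<^sup>2)" .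
  moreover have "1 / p \<le> q / t" if "t \<le> q * p" "0 < t" "0 < p" for p q t :: real
    using that by (simp add: field_simps)
  ultimately show ?thesis using r by (simp add: add_pos_nonneg)
qed

lemma summable_inverse_one_plus_square: "summable (\<lambda>n. 1 / (1 + (real n)\<^sup>2))"
proof (rule summable_comparison_test_ev)
  show "\<forall>\<^sub>F n in sequentially. norm (1 / (1 + (real n)\<^sup>2)) \<le> inverse (real n ^ 2)"
    using eventually_gt_at_top[of 0]
    by eventually_elim (auto simp: field_simps add_pos_nonneg)
  show "summable (\<lambda>n. inverse (real n ^ 2))" by (rule inverse_power_summable) auto
qed

definition shifted_gauss_sum :: "complex \<Rightarrow> real \<Rightarrow> real \<Rightarrow> complex" where
  "shifted_gauss_sum w a s = (\<Sum>n. w ^ n * of_real (exp (- s * (real n + a)\<^sup>2)))"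

text \<open>The derivatives of e^(-r^2 x^2), numbered from 1 so that index 0 is free for its
  primitive. The offset mirrors the factor X in X e^(aX): the constant coefficient of the generating
  series goes with an integral.\<close>

fun gauss_scaled :: "real \<Rightarrow> nat \<Rightarrow> real \<Rightarrow> real" where
  "gauss_scaled r 0 x = gauss_prim (r * x) / r"
| "gauss_scaled r (Suc k) x = r ^ k * gauss_deriv k (r * x)"

lemma gauss_scaled_prim_has_derivative:
  assumes "r > 0" "x \<ge> 0"
  shows "(gauss_scaled r 0 has_real_derivative gauss_scaled r 1 x) (at x within {0..})"
proof -
  have "((\<lambda>x. gauss_prim (r * x)) has_real_derivative gauss_deriv 0 (r * x) * r) (at x within {0..})"
  proof (rule DERIV_image_chain[where g = "\<lambda>x. r * x" and f = gauss_prim, unfolded o_def])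
    show "((\<lambda>x. r * x) has_real_derivative r) (at x within {0..})" by (auto intro!: derivative_eq_intros)
    have "(gauss_prim has_real_derivative gauss_deriv 0 (r * x)) (at (r * x) within {0..})"
      using assms by (intro gauss_prim_has_derivative) auto
    thus "(gauss_prim has_real_derivative gauss_deriv 0 (r * x)) (at (r * x) within (*) r ` {0..})"
      by (rule has_field_derivative_subset) (use assms in auto)
  qed
  hence "((\<lambda>x. gauss_prim (r * x) / r) has_real_derivative gauss_deriv 0 (r * x) * r / r) (at x within {0..})"
    by (rule DERIV_cdivide)
  moreover have "gauss_scaled r 0 = (\<lambda>x. gauss_prim (r * x) / r)" by auto
  ultimately show ?thesis using assms by simp
qed

lemma gauss_scaled_has_derivative:
  assumes "k \<ge> 1"
  shows "(gauss_scaled r k has_real_derivative gauss_scaled r (Suc k) x) (at x)"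
proof -
  obtain m where m: "k = Suc m" using assms by (cases k) auto
  have "((\<lambda>x. gauss_deriv m (r * x)) has_real_derivative gauss_deriv (Suc m) (r * x) * r) (at x)"
    by (rule DERIV_chain2[OF gauss_deriv_has_derivative]) (auto intro!: derivative_eq_intros)
  hence "((\<lambda>x. r ^ m * gauss_deriv m (r * x)) has_real_derivative r ^ m * (gauss_deriv (Suc m) (r * x) * r)) (at x)"
    by (rule DERIV_cmult)
  moreover have "gauss_scaled r k = (\<lambda>x. r ^ m * gauss_deriv m (r * x))" unfolding m by auto
  ultimately show ?thesis unfolding m by (simp add: mult_ac)
qed

lemma gauss_scaled_tendsto_0:
  assumes "r > 0"
  shows "(\<lambda>n. gauss_scaled r k (real n)) \<longlonglongrightarrow> 0"
proof (cases k)
  case 0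
  have "filterlim (\<lambda>n. r * real n) at_top sequentially"
    using assms by (intro filterlim_tendsto_pos_mult_at_top[OF tendsto_const] filterlim_real_sequentially)
  hence "(\<lambda>n. gauss_prim (r * real n)) \<longlonglongrightarrow> 0"
    by (rule filterlim_compose[OF gauss_prim_tendsto_0])
  hence "(\<lambda>n. gauss_prim (r * real n) / r) \<longlonglongrightarrow> 0 / r"
    by (intro tendsto_divide) (use assms in auto)
  thus ?thesis using 0 by simp
next
  case (Suc m)
  obtain C where C: "C > 0" "\<And>x. \<bar>gauss_deriv m x\<bar> \<le> C / (1 + x\<^sup>2)" using gauss_deriv_decay by blast
  have "(\<lambda>n. r ^ m * gauss_deriv m (r * real n)) \<longlonglongrightarrow> 0"
  proof (rule tendsto_mult_right_zero, rule Lim_null_comparison)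
    show "\<forall>\<^sub>F n in sequentially. norm (gauss_deriv m (r * real n)) \<le> C / (1 + (r * real n)\<^sup>2)"
      by (intro always_eventually allI) (simp only: C(2) real_norm_def)
    show "(\<lambda>n. C / (1 + (r * real n)\<^sup>2)) \<longlonglongrightarrow> 0" using assms by real_asymp
  qed
  thus ?thesis using Suc by simp
qed

lemma gauss_scaled_1: "gauss_scaled r 1 x = exp (- r\<^sup>2 * x\<^sup>2)"
  by (simp add: power_mult_distrib)

text \<open>The defect of the antidifference at n is at most a constant times r^K / (r^2 (1 + n^2)):
  two powers of r are spent on summability uniform in r, leaving r^(K - 2).\<close>

lemma euler_maclaurin_gauss:
  fixes b :: "complex fps" and w :: complex and a :: real and K :: nat
  assumes b: "b * (1 - fps_const w * fps_exp 1) = fps_X * fps_exp (of_real a)"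
    and w: "norm w \<le> 1" and K: "K \<ge> 2"
  obtains A where "\<And>r. 0 < r \<Longrightarrow> r \<le> 1 \<Longrightarrow>
       norm (shifted_gauss_sum w a (r\<^sup>2) - (\<Sum>k\<le>K. fps_nth b k * of_real (gauss_scaled r k 0))) \<le> A * r ^ (K - 2)"
proof (rule antidifference_error[OF b w])
  show "K \<ge> 1" using K by simp
next
  fix A assume A: "A > 0"
    "\<And>\<phi> u D. (\<And>x. x \<ge> 0 \<Longrightarrow> (\<phi> 0 has_real_derivative \<phi> 1 x) (at x within {0..})) \<Longrightarrow>
       (\<And>k x. k \<ge> 1 \<Longrightarrow> (\<phi> k has_real_derivative \<phi> (Suc k) x) (at x)) \<Longrightarrow>
       u \<ge> 0 \<Longrightarrow> (\<And>x. \<bar>x - u\<bar> \<le> \<bar>a\<bar> + 1 \<Longrightarrow> \<bar>\<phi> (Suc K) x\<bar> \<le> D) \<Longrightarrow>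
       norm (of_real (\<phi> 1 (u + a)) - ((\<Sum>k\<le>K. fps_nth b k * of_real (\<phi> k u))
          - w * (\<Sum>k\<le>K. fps_nth b k * of_real (\<phi> k (u + 1))))) \<le> A * D"
  obtain C where C: "C > 0" "\<And>x. \<bar>gauss_deriv K x\<bar> \<le> C / (1 + x\<^sup>2)" using gauss_deriv_decay by blast
  define C' where "C' = A * (C * (2 * (1 + (\<bar>a\<bar> + 1)\<^sup>2)))"
  define \<sigma> where "\<sigma> = (\<Sum>n. 1 / (1 + (real n)\<^sup>2))"
  have "norm (shifted_gauss_sum w a (r\<^sup>2) - (\<Sum>k\<le>K. fps_nth b k * of_real (gauss_scaled r k 0)))
          \<le> C' * \<sigma> * r ^ (K - 2)" if r: "0 < r" "r \<le> 1" for r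
  proof -
    define H where "H = (\<lambda>n. \<Sum>k\<le>K. fps_nth b k * of_real (gauss_scaled r k (real n)))"
    define e where "e = (\<lambda>n. of_real (gauss_scaled r 1 (real n + a)) - (H n - w * H (Suc n)))"
    have Hs: "H (Suc n) = (\<Sum>k\<le>K. fps_nth b k * of_real (gauss_scaled r k (real n + 1)))" for n
      unfolding H_def of_nat_Suc by (simp only: add.commute)
    have e: "norm (e n) \<le> C' * r ^ (K - 2) * (1 / (1 + (real n)\<^sup>2))" for n
    proof -
      have "norm (e n) \<le> A * (r ^ K * (C * (2 * (1 + (\<bar>a\<bar> + 1)\<^sup>2) / (r\<^sup>2 * (1 + (real n)\<^sup>2)))))"
        unfolding e_def Hs unfolding H_def
      proof (rule A(2)[of "gauss_scaled r"])
        fix x assume x: "\<bar>x - real n\<bar> \<le> \<bar>a\<bar> + 1"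
        have "\<bar>gauss_scaled r (Suc K) x\<bar> \<le> r ^ K * (C * (1 / (1 + (r * x)\<^sup>2)))"
          using mult_left_mono[OF C(2)[of "r * x"], of "r ^ K"] r by (simp add: abs_mult)
        also have "\<dots> \<le> r ^ K * (C * (2 * (1 + (\<bar>a\<bar> + 1)\<^sup>2) / (r\<^sup>2 * (1 + (real n)\<^sup>2))))"
          using C(1) r x by (intro mult_left_mono inverse_one_plus_square_near) auto
        finally show "\<bar>gauss_scaled r (Suc K) x\<bar> \<le> \<dots>" .
      qed (use r in \<open>auto intro!: gauss_scaled_prim_has_derivative[unfolded One_nat_def] gauss_scaled_has_derivative simp del: gauss_scaled.simps\<close>)
      also have "r ^ K = r ^ (K - 2) * r\<^sup>2" using K by (simp only: le_add_diff_inverse2 flip: power_add)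
      finally show ?thesis using r by (simp add: C'_def mult_ac)
    qed
    have summ: "summable (\<lambda>n. C' * r ^ (K - 2) * (1 / (1 + (real n)\<^sup>2)))"
      by (intro summable_mult summable_inverse_one_plus_square)
    have wn: "norm (w ^ n) \<le> 1" for n using w by (simp add: norm_power power_le_one)
    have we: "norm (w ^ n * e n) \<le> C' * r ^ (K - 2) * (1 / (1 + (real n)\<^sup>2))" for n
      using mult_mono[OF wn[of n] e[of n]] by (simp add: norm_mult)
    have we_sums: "(\<lambda>n. w ^ n * e n) sums (\<Sum>n. w ^ n * e n)"
      by (intro summable_sums summable_comparison_test[OF _ summ]) (use we in auto)
    \<comment> \<open>The boundary term at infinity: |w| \<le> 1 keeps the twist harmless, and every
      entry of \<open>gauss_scaled\<close>, including the normalised primitive, tends to 0.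
      Telescoping therefore leaves \<open>H 0\<close> and the summed defects.\<close>
    have "(\<lambda>n. w ^ n * H n) \<longlonglongrightarrow> 0"
    proof (rule Lim_null_comparison)
      show "\<forall>\<^sub>F n in sequentially. norm (w ^ n * H n) \<le> norm (H n)"
        by (intro always_eventually allI) (simp only: norm_mult mult_left_le_one_le wn norm_ge_zero)
      have "(\<lambda>n. fps_nth b k * of_real (gauss_scaled r k (real n))) \<longlonglongrightarrow> 0" for k
        using tendsto_mult_right_zero[OF tendsto_of_real[OF gauss_scaled_tendsto_0[OF r(1), of k], unfolded of_real_0]] .
      hence "H \<longlonglongrightarrow> 0" unfolding H_def by (intro tendsto_null_sum) auto
      thus "(\<lambda>n. norm (H n)) \<longlonglongrightarrow> 0" by (rule tendsto_norm_zero)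
    qed
    hence "(\<lambda>n. w ^ n * H n - w ^ Suc n * H (Suc n)) sums (w ^ 0 * H 0 - 0)"
      by (rule telescope_sums')
    from sums_add[OF this we_sums]
    have "(\<lambda>n. w ^ n * of_real (gauss_scaled r 1 (real n + a))) sums (H 0 + (\<Sum>n. w ^ n * e n))"
      by (simp add: e_def algebra_simps)
    hence "shifted_gauss_sum w a (r\<^sup>2) = H 0 + (\<Sum>n. w ^ n * e n)"
      by (simp add: shifted_gauss_sum_def sums_iff gauss_scaled_1 power_mult_distrib)
    hence "norm (shifted_gauss_sum w a (r\<^sup>2) - (\<Sum>k\<le>K. fps_nth b k * of_real (gauss_scaled r k 0)))
       = norm (\<Sum>n. w ^ n * e n)" by (simp add: H_def)
    also have "\<dots> \<le> (\<Sum>n. C' * r ^ (K - 2) * (1 / (1 + (real n)\<^sup>2)))"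
      using we_sums we summ by (intro norm_suminf_le) (auto simp: sums_iff)
    also have "\<dots> = C' * r ^ (K - 2) * \<sigma>"
      unfolding \<sigma>_def by (rule suminf_mult[OF summable_inverse_one_plus_square])
    finally show ?thesis by (simp add: mult_ac)
  qed
  thus thesis by (rule that)
qed

text \<open>Order K = 2 N + 4 with r = sqrt s gives the error r^(2 N + 2) = s^(N + 1). The sum then
  reaches one index beyond N, and this surplus term, itself of order s^(N + 1), joins the
  error.\<close>

lemma shifted_gauss_sum_asymp:
  fixes b :: "complex fps" and w :: complex and a :: real and N :: nat
  assumes b: "b * (1 - fps_const w * fps_exp 1) = fps_X * fps_exp (of_real a)"
    and w: "norm w \<le> 1"
  obtains A where "\<And>s. 0 < s \<Longrightarrow> s \<le> 1 \<Longrightarrow>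
     norm (shifted_gauss_sum w a s - (- fps_nth b 0 * of_real (sqrt pi / (2 * sqrt s))
       + (\<Sum>k=0..N. fps_nth b (2 * k + 1) * of_real ((- s) ^ k * fact (2 * k) / fact k)))) \<le> A * s ^ (N + 1)"
proof -
  define M where "M = N + 1"
  have even0: "gauss_scaled r (Suc (2 * k + 1)) 0 = 0" for r k
    unfolding gauss_scaled.simps mult_zero_right gauss_deriv_odd_0 by simp
  have odd0: "gauss_scaled r (2 * k + 1) 0 = (- (r\<^sup>2)) ^ k * fact (2 * k) / fact k" for r k
  proof -
    have "(- (r\<^sup>2)) ^ k = r ^ (2 * k) * (- 1) ^ k"
      unfolding power_minus[of "r\<^sup>2"] power_mult by (rule mult.commute)
    moreover have "gauss_scaled r (2 * k + 1) 0 = r ^ (2 * k) * gauss_deriv (2 * k) 0" by simp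
    ultimately show ?thesis by (simp only: gauss_deriv_even_0 times_divide_eq_right mult.assoc)
  qed
  have split: "(\<Sum>k\<le>2*M+2. fps_nth b k * of_real (gauss_scaled r k 0))
      = - fps_nth b 0 * of_real (sqrt pi / (2 * r))
       + (\<Sum>k\<le>M. fps_nth b (2 * k + 1) * of_real ((- (r\<^sup>2)) ^ k * fact (2 * k) / fact k))" for r
  proof (induction M)
    case 0
    show ?case using even0[of r 0] odd0[of r 0] by (simp add: numeral_2_eq_2 gauss_prim_0 del: gauss_scaled.simps(2))
  next
    case (Suc m)
    have "2 * Suc m + 2 = Suc (Suc (2 * m + 2))" by simp
    moreover have "Suc (2 * m + 2) = 2 * Suc m + 1" by simp
    moreover have "gauss_scaled r (Suc (Suc (2 * m + 2))) 0 = 0" using even0[of r "Suc m"] by simp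
    ultimately show ?case
      using Suc odd0[of r "Suc m"] by (simp del: gauss_scaled.simps)
  qed
  obtain A where A: "\<And>r. 0 < r \<Longrightarrow> r \<le> 1 \<Longrightarrow>
       norm (shifted_gauss_sum w a (r\<^sup>2) - (\<Sum>k\<le>2*M+2. fps_nth b k * of_real (gauss_scaled r k 0)))
         \<le> A * r ^ (2 * M + 2 - 2)"
    using euler_maclaurin_gauss[OF b w, of "2*M+2"] by auto
  define B where "B = norm (fps_nth b (2 * M + 1)) * (fact (2 * M) / fact M)"
  show ?thesis
  proof (rule that)
    fix s :: real assume s: "0 < s" "s \<le> 1"
    define X where "X = - fps_nth b 0 * of_real (sqrt pi / (2 * sqrt s))
       + (\<Sum>k=0..N. fps_nth b (2 * k + 1) * of_real ((- s) ^ k * fact (2 * k) / fact k))"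
    define Y where "Y = fps_nth b (2 * M + 1) * of_real ((- s) ^ M * fact (2 * M) / fact M)"
    have sq: "(sqrt s)\<^sup>2 = s" using s by simp
    have last: "(\<Sum>k\<le>M. g k) = (\<Sum>k=0..N. g k) + g M" for g :: "nat \<Rightarrow> complex"
      by (simp add: M_def atLeast0AtMost)
    have XY: "(\<Sum>k\<le>2*M+2. fps_nth b k * of_real (gauss_scaled (sqrt s) k 0)) = X + Y"
      unfolding split sq last X_def Y_def by (simp only: add.assoc)
    have sM: "(sqrt s) ^ (2 * M + 2 - 2) = s ^ M" by (simp only: add_diff_cancel_right' power_mult sq)
    have "norm (shifted_gauss_sum w a s - (X + Y)) \<le> A * s ^ M"
      using A[of "sqrt s"] s unfolding sq XY sM by simp
    moreover have "norm Y = B * s ^ M"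
      using s by (simp add: Y_def B_def norm_mult norm_divide norm_power)
    ultimately have "norm (shifted_gauss_sum w a s - X) \<le> A * s ^ M + B * s ^ M"
      using norm_triangle_ineq[of "shifted_gauss_sum w a s - (X + Y)" Y] by simp
    thus "norm (shifted_gauss_sum w a s - X) \<le> (A + B) * s ^ (N + 1)"
      by (simp add: M_def algebra_simps)
  qed
qed

section \<open>Poisson summation for Gaussians\<close>

abbreviation fourier_char :: "int \<Rightarrow> complex \<Rightarrow> complex" where
  "fourier_char m x \<equiv> exp (- (2 * of_real pi * \<i> * of_int m * x))"

lemma fourier_char_integral:
  "integral {- 1 / 2..1 / 2} (\<lambda>x::real. fourier_char m (of_real x)) = (if m = 0 then 1 else 0)"
proof (cases "m = 0")
  case False
  define c where "c = - (2 * of_real pi * \<i> * of_int m)"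
  have c: "c \<noteq> 0" using False by (auto simp: c_def)
  have "((\<lambda>x::real. exp (c * of_real x)) has_integral
      exp (c * of_real (1 / 2)) / c - exp (c * of_real (- 1 / 2)) / c) {- 1 / 2..1 / 2}"
  proof (rule fundamental_theorem_of_calculus)
    fix x :: real
    have "((\<lambda>z. exp (c * z) / c) has_field_derivative exp (c * of_real x)) (at (of_real x))"
      using c by (auto intro!: derivative_eq_intros)
    thus "((\<lambda>x. exp (c * of_real x) / c) has_vector_derivative exp (c * of_real x))
        (at x within {- 1 / 2..1 / 2})"
      by (rule has_vector_derivative_real_field)
  qed auto
  moreover have "exp (c * of_real (1 / 2)) = exp (c * of_real (- 1 / 2))"
    unfolding exp_eq by (intro exI[of _ "- m"]) (simp add: c_def algebra_simps)
  ultimately show ?thesis using False by (simp add: c_def integral_unique mult_ac)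
qed auto

text \<open>Integration by parts against the character. Nothing makes g periodic, so the boundary
  values remain and contribute 2 B. The rate 1/|m| is enough because only two coefficients survive
  the later telescoping.\<close>

lemma riemann_lebesgue_holomorphic:
  assumes g: "g holomorphic_on ball 0 1"
  shows "\<exists>C. \<forall>m. m \<noteq> 0 \<longrightarrow> norm (integral {- 1 / 2..1 / 2} (\<lambda>x::real. g (of_real x) * fourier_char m (of_real x)))
    \<le> C / \<bar>real_of_int m\<bar>"
proof -
  have sub: "complex_of_real ` {- 1 / 2..1 / 2} \<subseteq> ball 0 1" by (auto simp: dist_norm)
  have dg: "deriv g holomorphic_on ball 0 1" using g by (intro holomorphic_deriv) auto
  have cg: "continuous_on {- 1 / 2..1 / 2} (\<lambda>x. g (complex_of_real x))"
    by (intro continuous_on_compose2[OF holomorphic_on_imp_continuous_on[OF g] _ sub] continuous_intros)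
  have cdg: "continuous_on {- 1 / 2..1 / 2} (\<lambda>x. deriv g (complex_of_real x))"
    by (intro continuous_on_compose2[OF holomorphic_on_imp_continuous_on[OF dg] _ sub] continuous_intros)
  have "compact ((\<lambda>x. g (complex_of_real x)) ` {- 1 / 2..1 / 2})"
    by (intro compact_continuous_image cg) auto
  then obtain B where B: "\<And>x. x \<in> {- 1 / 2..1 / 2} \<Longrightarrow> norm (g (complex_of_real x)) \<le> B"
    by (meson bounded_iff compact_imp_bounded imageI)
  have "compact ((\<lambda>x. deriv g (complex_of_real x)) ` {- 1 / 2..1 / 2})"
    by (intro compact_continuous_image cdg) auto
  then obtain B' where B': "\<And>x. x \<in> {- 1 / 2..1 / 2} \<Longrightarrow> norm (deriv g (complex_of_real x)) \<le> B'"
    by (meson bounded_iff compact_imp_bounded imageI)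
  have "norm (integral {- 1 / 2..1 / 2} (\<lambda>x::real. g (of_real x) * fourier_char m (of_real x)))
      \<le> (B' + 2 * B) / \<bar>real_of_int m\<bar>" if m: "m \<noteq> 0" for m
  proof -
    define c where "c = 2 * of_real pi * \<i> * complex_of_int m"
    have n1: "norm (fourier_char m (of_real x)) = 1" for x :: real by simp
    let ?I = "integral {- 1 / 2..1 / 2} (\<lambda>x::real. g (of_real x) * fourier_char m (of_real x))"
    let ?J = "integral {- 1 / 2..1 / 2} (\<lambda>x::real. deriv g (of_real x) * fourier_char m (of_real x))"
    let ?G = "\<lambda>x::real. g (of_real x) * fourier_char m (of_real x)"
    have iI: "((\<lambda>x::real. g (of_real x) * fourier_char m (of_real x)) has_integral ?I) {- 1 / 2..1 / 2}"
      by (intro integrable_integral integrable_continuous_interval continuous_intros cg)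
    have iJ: "((\<lambda>x::real. deriv g (of_real x) * fourier_char m (of_real x)) has_integral ?J) {- 1 / 2..1 / 2}"
      by (intro integrable_integral integrable_continuous_interval continuous_intros cdg)
    have "((\<lambda>x::real. deriv g (of_real x) * fourier_char m (of_real x)
          - c * (g (of_real x) * fourier_char m (of_real x))) has_integral ?G (1 / 2) - ?G (- 1 / 2)) {- 1 / 2..1 / 2}"
    proof (rule fundamental_theorem_of_calculus)
      fix x :: real assume x: "x \<in> {- 1 / 2..1 / 2}"
      have "(g has_field_derivative deriv g (of_real x)) (at (of_real x))"
        using x sub by (intro holomorphic_derivI[OF g]) auto
      hence "((\<lambda>z. g z * fourier_char m z) has_field_derivative
          deriv g (of_real x) * fourier_char m (of_real x) - c * (g (of_real x) * fourier_char m (of_real x))) (at (of_real x))"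
        by (auto intro!: derivative_eq_intros simp: c_def algebra_simps)
      thus "(?G has_vector_derivative deriv g (of_real x) * fourier_char m (of_real x)
          - c * (g (of_real x) * fourier_char m (of_real x))) (at x within {- 1 / 2..1 / 2})"
        by (rule has_vector_derivative_real_field)
    qed auto
    hence "?G (1 / 2) - ?G (- 1 / 2) = ?J - c * ?I"
      using has_integral_diff[OF iJ has_integral_mult_right[OF iI, of c]] by (rule has_integral_unique)
    hence "c * ?I = ?J - ?G (1 / 2) + ?G (- 1 / 2)" by (simp add: algebra_simps)
    hence "norm (c * ?I) \<le> norm ?J + norm (?G (1 / 2)) + norm (?G (- 1 / 2))"
      using norm_triangle_ineq[of "?J - ?G (1 / 2)" "?G (- 1 / 2)"] norm_triangle_ineq4[of ?J "?G (1 / 2)"]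
      by (simp only:)
    also have "norm ?J \<le> B' * measure lborel {- 1 / 2..1 / 2::real}"
    proof (rule has_integral_bound_real[OF _ finite.emptyI iJ])
      show "0 \<le> B'" using order_trans[OF norm_ge_zero B'[of 0]] by simp
    qed (use B' in \<open>simp add: norm_mult n1\<close>)
    also have "norm (?G (1 / 2)) \<le> B" using B[of "1 / 2"] by (simp add: norm_mult)
    also have "norm (?G (- 1 / 2)) \<le> B" using B[of "- 1 / 2"] by (simp add: norm_mult)
    finally have "norm c * norm ?I \<le> B' + 2 * B" by (simp add: norm_mult)
    moreover have "\<bar>real_of_int m\<bar> * norm ?I \<le> norm c * norm ?I"
    proof (rule mult_right_mono)
      have "1 * \<bar>real_of_int m\<bar> \<le> (2 * pi) * \<bar>real_of_int m\<bar>"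
        using pi_ge_two by (intro mult_right_mono) auto
      thus "\<bar>real_of_int m\<bar> \<le> norm c" by (simp add: c_def norm_mult)
    qed auto
    ultimately show ?thesis using m by (simp add: field_simps)
  qed
  thus ?thesis by blast
qed

lemma sum_int_symmetric_telescope:
  fixes h :: "int \<Rightarrow> 'a :: ab_group_add"
  shows "(\<Sum>m\<in>{- int M..int M}. h (m - 1) - h m) = h (- int M - 1) - h (int M)"
proof (induction M)
  case (Suc M)
  have "{- int (Suc M)..int (Suc M)} = insert (- int (Suc M)) (insert (int (Suc M)) {- int M..int M})"
    by auto
  moreover have "h (- int (Suc M)) = h (- int M - 1)" by (rule arg_cong[of _ _ h]) simp
  moreover have "h (int (Suc M) - 1) = h (int M)" by simp
  ultimately show ?case using Suc by simp
qed auto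

text \<open>Chernoff's proof of the Dirichlet theorem: writing \<open>f(x) - f(0) = (e\<^bsup>2\<pi>ix\<^esup> - 1) g(x)\<close>, the
  symmetric partial sums of the Fourier coefficients of \<open>f\<close> telescope.\<close>

lemma fourier_series_at_0:
  assumes f: "f holomorphic_on ball 0 1"
  shows "(\<lambda>M. \<Sum>m\<in>{- int M..int M}. integral {- 1 / 2..1 / 2} (\<lambda>x::real. f (of_real x) * fourier_char m (of_real x)))
    \<longlonglongrightarrow> f 0"
proof -
  define E where "E = (\<lambda>z::complex. exp (2 * of_real pi * \<i> * z))"
  \<comment> \<open>Both difference quotients are completed at 0 by the derivative and so are
    holomorphic. Their quotient realises (f z - f 0) / (E z - 1) without a singularity at 0.\<close>
  define q1 where "q1 = (\<lambda>z. if z = 0 then deriv f 0 else (f z - f 0) / (z - 0))"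
  define q2 where "q2 = (\<lambda>z. if z = 0 then deriv E 0 else (E z - E 0) / (z - 0))"
  define g where "g = (\<lambda>z. q1 z / q2 z)"
  have E: "E holomorphic_on ball 0 1" unfolding E_def by (intro holomorphic_intros)
  have "(E has_field_derivative 2 * of_real pi * \<i>) (at 0)"
    unfolding E_def by (auto intro!: derivative_eq_intros)
  hence dE: "deriv E 0 = 2 * of_real pi * \<i>" by (rule DERIV_imp_deriv)
  \<comment> \<open>\<open>E z = 1\<close> only at integers, and 0 is the only integer in the open
    unit disc; this is the reason for the radius 1.\<close>
  have E1: "E z \<noteq> 1" if "z \<in> ball 0 1" "z \<noteq> 0" for z
  proof
    assume "E z = 1"
    then obtain n where n: "Im (2 * of_real pi * \<i> * z) = of_int (2 * n) * pi" "Re (2 * of_real pi * \<i> * z) = 0"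
      unfolding E_def exp_eq_1 by auto
    hence "z = of_int n" by (simp add: complex_eq_iff)
    thus False using that by auto
  qed
  have q2: "q2 z \<noteq> 0" if "z \<in> ball 0 1" for z
    using E1[OF that] dE by (auto simp: q2_def E_def)
  have g: "g holomorphic_on ball 0 1"
    unfolding g_def q1_def q2_def
    using q2 by (intro holomorphic_on_divide pole_lemma f E) (auto simp: q2_def)
  have fg: "f z = f 0 + (E z - 1) * g z" if "z \<in> ball 0 1" for z
    using q2[OF that] E1[OF that] by (auto simp: g_def q1_def q2_def E_def)
  define \<gamma> where "\<gamma> = (\<lambda>m. integral {- 1 / 2..1 / 2} (\<lambda>x::real. g (of_real x) * fourier_char m (of_real x)))"
  have sub: "complex_of_real ` {- 1 / 2..1 / 2} \<subseteq> ball 0 1" by (auto simp: dist_norm)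
  have cg: "continuous_on {- 1 / 2..1 / 2} (\<lambda>x. g (complex_of_real x))"
    by (intro continuous_on_compose2[OF holomorphic_on_imp_continuous_on[OF g] _ sub] continuous_intros)
  have i\<gamma>: "((\<lambda>x::real. g (of_real x) * fourier_char m (of_real x)) has_integral \<gamma> m) {- 1 / 2..1 / 2}" for m
    unfolding \<gamma>_def by (intro integrable_integral integrable_continuous_interval continuous_intros cg)
  have i1: "((\<lambda>x::real. fourier_char m (of_real x)) has_integral (if m = 0 then 1 else 0)) {- 1 / 2..1 / 2}" for m
    unfolding fourier_char_integral[symmetric]
    by (intro integrable_integral integrable_continuous_interval continuous_intros)
  have coeff: "integral {- 1 / 2..1 / 2} (\<lambda>x::real. f (of_real x) * fourier_char m (of_real x))
      = (if m = 0 then f 0 else 0) + (\<gamma> (m - 1) - \<gamma> m)" for m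
  proof (rule integral_unique)
    have "((\<lambda>x::real. f 0 * fourier_char m (of_real x) + (g (of_real x) * fourier_char (m - 1) (of_real x)
        - g (of_real x) * fourier_char m (of_real x))) has_integral
          (f 0 * (if m = 0 then 1 else 0) + (\<gamma> (m - 1) - \<gamma> m))) {- 1 / 2..1 / 2}"
      by (intro has_integral_add has_integral_diff has_integral_mult_right i\<gamma> i1)
    moreover have "f 0 * fourier_char m (of_real x) + (g (of_real x) * fourier_char (m - 1) (of_real x)
        - g (of_real x) * fourier_char m (of_real x)) = f (of_real x) * fourier_char m (of_real x)"
      if x: "x \<in> {- 1 / 2..1 / 2}" for x :: real
    proof -
      have eq1: "fourier_char (m - 1) (of_real x) = E (of_real x) * fourier_char m (of_real x)"
        unfolding E_def exp_add[symmetric] by (rule arg_cong[of _ _ exp]) (simp add: algebra_simps)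
      have eq2: "f (of_real x) = f 0 + (E (of_real x) - 1) * g (of_real x)"
        using x sub by (intro fg) auto
      show ?thesis unfolding eq1 eq2 by (simp only: ring_distribs mult_1 mult_ac)
    qed
    ultimately have "((\<lambda>x::real. f (of_real x) * fourier_char m (of_real x)) has_integral
          (f 0 * (if m = 0 then 1 else 0) + (\<gamma> (m - 1) - \<gamma> m))) {- 1 / 2..1 / 2}"
      by (rule has_integral_eq[rotated])
    thus "((\<lambda>x::real. f (of_real x) * fourier_char m (of_real x)) has_integral
          ((if m = 0 then f 0 else 0) + (\<gamma> (m - 1) - \<gamma> m))) {- 1 / 2..1 / 2}"
      by (simp split: if_splits)
  qed
  have sum_eq: "(\<Sum>m\<in>{- int M..int M}. integral {- 1 / 2..1 / 2} (\<lambda>x::real. f (of_real x) * fourier_char m (of_real x)))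
      = f 0 + (\<gamma> (- int M - 1) - \<gamma> (int M))" for M
    unfolding coeff sum.distrib sum_int_symmetric_telescope by simp
  obtain C where C: "\<And>m. m \<noteq> 0 \<Longrightarrow> norm (\<gamma> m) \<le> C / \<bar>real_of_int m\<bar>"
    using riemann_lebesgue_holomorphic[OF g] unfolding \<gamma>_def by blast
  have l1: "(\<lambda>M. \<gamma> (- int M - 1)) \<longlonglongrightarrow> 0"
  proof (rule Lim_null_comparison)
    show "\<forall>\<^sub>F M in sequentially. norm (\<gamma> (- int M - 1)) \<le> C / (real M + 1)"
    proof (intro always_eventually allI)
      fix M show "norm (\<gamma> (- int M - 1)) \<le> C / (real M + 1)"
        using C[of "- int M - 1"] by (simp add: abs_if algebra_simps)
    qed
    show "(\<lambda>M. C / (real M + 1)) \<longlonglongrightarrow> 0" by real_asymp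
  qed
  have l2: "(\<lambda>M. \<gamma> (int M)) \<longlonglongrightarrow> 0"
  proof (rule Lim_null_comparison)
    show "\<forall>\<^sub>F M in sequentially. norm (\<gamma> (int M)) \<le> C / real M"
      using eventually_gt_at_top[of 0]
    proof eventually_elim
      case (elim M) thus ?case using C[of "int M"] by simp
    qed
    show "(\<lambda>M. C / real M) \<longlonglongrightarrow> 0" by real_asymp
  qed
  show ?thesis unfolding sum_eq
    using tendsto_add[OF tendsto_const[of "f 0"] tendsto_diff[OF l1 l2]] by simp
qed

text \<open>An affine substitution in the characteristic function of the standard normal
  distribution: the real part of c moves the centre of the Gaussian to Re c / (2 s), the imaginary
  part supplies the frequency.\<close>

lemma gauss_fourier_transform:
  fixes s :: real and c :: complex
  assumes s: "s > 0"
  shows "has_bochner_integral lborel (\<lambda>x. exp (- of_real s * (of_real x)\<^sup>2 + c * of_real x))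
           (of_real (sqrt (pi / s)) * exp (c\<^sup>2 / (4 * of_real s)))"
proof -
  define v where "v = Im c"
  define u where "u = Re c / (2 * s)"
  define t where "t = v / sqrt (2 * s)"
  have r: "sqrt (2 * s) > 0" using s by simp
  have "integrable std_normal_distribution (\<lambda>x. iexp (t * x))"
    using real_dist_normal_dist
    by (intro finite_measure.integrable_const_bound[where B = 1])
       (auto simp: real_distribution_def prob_space_def real_distribution_axioms_def)
  hence "integrable lborel (\<lambda>x. std_normal_density x *\<^sub>R iexp (t * x))"
    by (subst (asm) integrable_density) auto
  moreover have "(\<integral>x. std_normal_density x *\<^sub>R iexp (t * x) \<partial>lborel) = complex_of_real (exp (- (t^2) / 2))"
    using fun_cong[OF char_std_normal_distribution, of t] unfolding char_def
    by (subst (asm) integral_density) auto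
  ultimately have "has_bochner_integral lborel (\<lambda>x. std_normal_density x *\<^sub>R iexp (t * x))
      (complex_of_real (exp (- (t^2) / 2)))"
    by (simp add: has_bochner_integral_iff)
  hence "has_bochner_integral lborel
      (\<lambda>x. std_normal_density (- sqrt (2 * s) * u + sqrt (2 * s) * x) *\<^sub>R iexp (t * (- sqrt (2 * s) * u + sqrt (2 * s) * x)))
      (complex_of_real (exp (- (t^2) / 2)) /\<^sub>R \<bar>sqrt (2 * s)\<bar>)"
    using r by (subst (asm) lborel_has_bochner_integral_real_affine_iff[where c = "sqrt (2 * s)" and t = "- sqrt (2 * s) * u"]) auto
  hence "has_bochner_integral lborel
      (\<lambda>x. (of_real (sqrt (2 * pi)) * exp (of_real (s * u\<^sup>2) + \<i> * of_real (v * u))) *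
         (std_normal_density (- sqrt (2 * s) * u + sqrt (2 * s) * x) *\<^sub>R iexp (t * (- sqrt (2 * s) * u + sqrt (2 * s) * x))))
      ((of_real (sqrt (2 * pi)) * exp (of_real (s * u\<^sup>2) + \<i> * of_real (v * u))) *
         (complex_of_real (exp (- (t^2) / 2)) /\<^sub>R \<bar>sqrt (2 * s)\<bar>))"
    by (rule has_bochner_integral_mult_right)
  also have "(\<lambda>x. (of_real (sqrt (2 * pi)) * exp (of_real (s * u\<^sup>2) + \<i> * of_real (v * u))) *
         (std_normal_density (- sqrt (2 * s) * u + sqrt (2 * s) * x) *\<^sub>R iexp (t * (- sqrt (2 * s) * u + sqrt (2 * s) * x))))
      = (\<lambda>x. exp (- of_real s * (of_real x)\<^sup>2 + c * of_real x))"
  proof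
    fix x :: real
    have e1: "(- sqrt (2 * s) * u + sqrt (2 * s) * x)\<^sup>2 / 2 = s * (x - u)\<^sup>2"
    proof -
      have "- sqrt (2 * s) * u + sqrt (2 * s) * x = sqrt (2 * s) * (x - u)" by (simp add: algebra_simps)
      thus ?thesis using s by (simp add: power_mult_distrib)
    qed
    have e2: "t * (- sqrt (2 * s) * u + sqrt (2 * s) * x) = v * (x - u)"
    proof -
      have "- sqrt (2 * s) * u + sqrt (2 * s) * x = sqrt (2 * s) * (x - u)" by (simp add: algebra_simps)
      thus ?thesis using r by (simp add: t_def)
    qed
    have "(of_real (sqrt (2 * pi)) * exp (of_real (s * u\<^sup>2) + \<i> * of_real (v * u))) *
         (std_normal_density (- sqrt (2 * s) * u + sqrt (2 * s) * x) *\<^sub>R iexp (t * (- sqrt (2 * s) * u + sqrt (2 * s) * x)))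
       = exp (of_real (s * u\<^sup>2) + \<i> * of_real (v * u)) * (of_real (exp (- (s * (x - u)\<^sup>2))) * iexp (v * (x - u)))"
      unfolding std_normal_density_def e2 minus_divide_left[symmetric] e1
      by (simp add: scaleR_conv_of_real)
    also have "\<dots> = exp (of_real (s * u\<^sup>2) + \<i> * of_real (v * u) + (of_real (- (s * (x - u)\<^sup>2)) + \<i> * of_real (v * (x - u))))"
      by (simp only: exp_add exp_of_real)
    also have "of_real (s * u\<^sup>2) + \<i> * of_real (v * u) + (of_real (- (s * (x - u)\<^sup>2)) + \<i> * of_real (v * (x - u)))
        = - of_real s * (of_real x)\<^sup>2 + c * of_real x"
      using s by (simp add: complex_eq_iff u_def v_def power2_eq_square field_simps)
    finally show "(of_real (sqrt (2 * pi)) * exp (of_real (s * u\<^sup>2) + \<i> * of_real (v * u))) *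
         (std_normal_density (- sqrt (2 * s) * u + sqrt (2 * s) * x) *\<^sub>R iexp (t * (- sqrt (2 * s) * u + sqrt (2 * s) * x)))
       = exp (- of_real s * (of_real x)\<^sup>2 + c * of_real x)" .
  qed
  also have "(of_real (sqrt (2 * pi)) * exp (of_real (s * u\<^sup>2) + \<i> * of_real (v * u))) *
         (complex_of_real (exp (- (t^2) / 2)) /\<^sub>R \<bar>sqrt (2 * s)\<bar>)
       = of_real (sqrt (pi / s)) * exp (c\<^sup>2 / (4 * of_real s))"
  proof -
    have "exp (of_real (s * u\<^sup>2) + \<i> * of_real (v * u)) * complex_of_real (exp (- (t^2) / 2))
        = exp (of_real (s * u\<^sup>2) + \<i> * of_real (v * u) + of_real (- (t^2) / 2))"
      by (simp only: exp_add exp_of_real)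
    also have "of_real (s * u\<^sup>2) + \<i> * of_real (v * u) + of_real (- (t^2) / 2) = c\<^sup>2 / (4 * of_real s)"
    proof -
      have "c\<^sup>2 = of_real ((Re c)\<^sup>2 - (Im c)\<^sup>2) + \<i> * of_real (2 * Re c * Im c)"
        by (simp add: complex_eq_iff power2_eq_square)
      moreover have "s * u\<^sup>2 + - (t\<^sup>2) / 2 = ((Re c)\<^sup>2 - (Im c)\<^sup>2) / (4 * s)"
        using s by (simp add: t_def u_def v_def power_divide power2_eq_square field_simps)
      moreover have "v * u = (2 * Re c * Im c) / (4 * s)"
        using s by (simp add: u_def v_def field_simps)
      moreover have "of_real (s * u\<^sup>2) + \<i> * of_real (v * u) + of_real (- (t^2) / 2)
          = of_real (s * u\<^sup>2 + - (t\<^sup>2) / 2) + \<i> * complex_of_real (v * u)" by simp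
      ultimately show ?thesis by (simp add: add_divide_distrib)
    qed
    finally have "exp (of_real (s * u\<^sup>2) + \<i> * of_real (v * u)) * complex_of_real (exp (- (t^2) / 2)) = exp (c\<^sup>2 / (4 * of_real s))" .
    moreover have "sqrt (2 * pi) / \<bar>sqrt (2 * s)\<bar> = sqrt (pi / s)"
      using s by (simp add: real_sqrt_mult real_sqrt_divide)
    moreover have "(of_real A * E) * (T /\<^sub>R q) = of_real (A / q) * (E * T)" for A q :: real and E T :: complex
      by (simp add: scaleR_conv_of_real divide_inverse)
    ultimately show ?thesis by (simp only:)
  qed
  finally show ?thesis .
qed

text \<open>Uniformity over a complex disc of y is what makes the periodized Gaussian holomorphic,
  and the geometric decay in |n| gives summable majorants for an arbitrary linear coefficient
  c.\<close>

lemma gauss_translate_bound: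
  fixes s \<rho> :: real and c :: complex
  assumes s: "s > 0"
  obtains C where "C > 0" "\<And>y n. norm y \<le> \<rho> \<Longrightarrow>
     norm (exp (- of_real s * (y + of_int n)\<^sup>2 + c * (y + of_int n))) \<le> C * exp (- \<bar>real_of_int n\<bar>)"
proof -
  \<comment> \<open>The total linear growth in |n| plus 1: the extra 1 reserves the factor e^(-|n|),
    and B m - s m^2 \<le> B^2 / (4 s), by completing the square, moves the rest into
    \<open>D\<close>.\<close>
  define B where "B = 2 * s * \<rho> + norm c + 1"
  define D where "D = s * \<rho>\<^sup>2 + norm c * \<rho> + B\<^sup>2 / (4 * s)"
  show ?thesis
  proof (rule that[of "exp D"])
    fix y :: complex and n :: int assume y: "norm y \<le> \<rho>"
    define m where "m = \<bar>real_of_int n\<bar>"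
    have "Re (- of_real s * (y + of_int n)\<^sup>2 + c * (y + of_int n))
        = Re (- of_real s * y\<^sup>2) + Re (- of_real s * (2 * of_int n) * y) - s * m\<^sup>2 + Re (c * y) + Re (c * of_int n)"
      by (simp add: power2_eq_square algebra_simps m_def)
    also have "\<dots> \<le> s * \<rho>\<^sup>2 + s * (2 * m) * \<rho> - s * m\<^sup>2 + norm c * \<rho> + norm c * m"
    proof -
      have "Re (- of_real s * y\<^sup>2) \<le> norm (- of_real s * y\<^sup>2)" by (rule complex_Re_le_cmod)
      also have "\<dots> = s * (norm y)\<^sup>2" using s by (simp add: norm_mult norm_power)
      also have "\<dots> \<le> s * \<rho>\<^sup>2" using s y by (intro mult_left_mono power_mono) auto
      finally have 1: "Re (- of_real s * y\<^sup>2) \<le> s * \<rho>\<^sup>2" .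
      have "Re (- of_real s * (2 * of_int n) * y) \<le> norm (- of_real s * (2 * of_int n) * y)" by (rule complex_Re_le_cmod)
      also have "\<dots> = s * (2 * m) * norm y" using s by (simp add: norm_mult m_def)
      also have "\<dots> \<le> s * (2 * m) * \<rho>" using s y by (intro mult_left_mono) (auto simp: m_def)
      finally have 2: "Re (- of_real s * (2 * of_int n) * y) \<le> s * (2 * m) * \<rho>" .
      have "Re (c * y) \<le> norm c * norm y" using complex_Re_le_cmod[of "c * y"] by (simp add: norm_mult)
      also have "\<dots> \<le> norm c * \<rho>" using y by (intro mult_left_mono) auto
      finally have 3: "Re (c * y) \<le> norm c * \<rho>" .
      have 4: "Re (c * of_int n) \<le> norm c * m" using complex_Re_le_cmod[of "c * of_int n"] by (simp add: norm_mult m_def)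
      show ?thesis using 1 2 3 4 by linarith
    qed
    also have "\<dots> = s * \<rho>\<^sup>2 + norm c * \<rho> + (B * m - s * m\<^sup>2) - m" by (simp add: B_def algebra_simps)
    also have "B * m - s * m\<^sup>2 \<le> B\<^sup>2 / (4 * s)"
    proof -
      have "0 \<le> (B - 2 * s * m)\<^sup>2" by simp
      hence "4 * s * (B * m - s * m\<^sup>2) \<le> B\<^sup>2" by (simp add: power2_eq_square algebra_simps)
      thus ?thesis using s by (simp add: field_simps)
    qed
    finally have "Re (- of_real s * (y + of_int n)\<^sup>2 + c * (y + of_int n)) \<le> D + - m" by (simp add: D_def)
    thus "norm (exp (- of_real s * (y + of_int n)\<^sup>2 + c * (y + of_int n))) \<le> exp D * exp (- \<bar>real_of_int n\<bar>)"
      unfolding norm_exp_eq_Re exp_add[symmetric] m_def by simp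
  qed auto
qed

lemma sum_int_symmetric:
  fixes h :: "int \<Rightarrow> 'a :: ab_group_add"
  shows "(\<Sum>n\<in>{- int R..int R}. h n) = h 0 + (\<Sum>k<R. h (int (Suc k)) + h (- int (Suc k)))"
proof (induction R)
  case (Suc R)
  have "{- int (Suc R)..int (Suc R)} = insert (- int (Suc R)) (insert (int (Suc R)) {- int R..int R})"
    by auto
  thus ?case using Suc by (simp add: algebra_simps)
qed auto

lemma integral_symmetric_unit_intervals:
  fixes \<psi> :: "real \<Rightarrow> complex"
  assumes \<psi>: "continuous_on UNIV \<psi>"
  shows "(\<Sum>n\<in>{- int R..int R}. integral {- 1 / 2..1 / 2} (\<lambda>x. \<psi> (x + of_int n)))
    = integral {- real R - 1 / 2..real R + 1 / 2} \<psi>"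
proof -
  have shift: "integral {- 1 / 2..1 / 2} (\<lambda>x. \<psi> (x + y)) = integral {y - 1 / 2..y + 1 / 2} \<psi>" for y
    using integral_shift_real_ivl[of "y - 1 / 2" y "y + 1 / 2" \<psi>] by simp
  have int: "\<psi> integrable_on {u..v}" for u v
    by (intro integrable_continuous_interval continuous_on_subset[OF \<psi>]) auto
  show ?thesis
  proof (induction R)
    case 0
    show ?case using shift[of 0] by simp
  next
    case (Suc R)
    have "{- int (Suc R)..int (Suc R)} = insert (- int (Suc R)) (insert (int (Suc R)) {- int R..int R})"
      by auto
    hence "(\<Sum>n\<in>{- int (Suc R)..int (Suc R)}. integral {- 1 / 2..1 / 2} (\<lambda>x. \<psi> (x + of_int n)))
       = integral {- 1 / 2..1 / 2} (\<lambda>x. \<psi> (x + of_int (- int (Suc R))))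
         + (integral {- 1 / 2..1 / 2} (\<lambda>x. \<psi> (x + of_int (int (Suc R)))) + integral {- real R - 1 / 2..real R + 1 / 2} \<psi>)"
      unfolding Suc[symmetric] by simp
    also have "integral {- 1 / 2..1 / 2} (\<lambda>x. \<psi> (x + of_int (- int (Suc R))))
        = integral {- real (Suc R) - 1 / 2..- real R - 1 / 2} \<psi>"
      unfolding shift by (rule arg_cong[where f = "\<lambda>A. integral A \<psi>"]) auto
    also have "integral {- 1 / 2..1 / 2} (\<lambda>x. \<psi> (x + of_int (int (Suc R))))
        = integral {real R + 1 / 2..real (Suc R) + 1 / 2} \<psi>"
      unfolding shift by (rule arg_cong[where f = "\<lambda>A. integral A \<psi>"]) auto
    also have "integral {real R + 1 / 2..real (Suc R) + 1 / 2} \<psi> + integral {- real R - 1 / 2..real R + 1 / 2} \<psi>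
        = integral {- real R - 1 / 2..real (Suc R) + 1 / 2} \<psi>"
      by (subst add.commute, rule Henstock_Kurzweil_Integration.integral_combine) (auto simp: int)
    also have "integral {- real (Suc R) - 1 / 2..- real R - 1 / 2} \<psi> + integral {- real R - 1 / 2..real (Suc R) + 1 / 2} \<psi>
        = integral {- real (Suc R) - 1 / 2..real (Suc R) + 1 / 2} \<psi>"
      by (rule Henstock_Kurzweil_Integration.integral_combine) (auto simp: int)
    finally show ?case .
  qed
qed

lemma integral_symmetric_tendsto_lborel:
  fixes \<psi> :: "real \<Rightarrow> complex"
  assumes \<psi>: "continuous_on UNIV \<psi>" and I: "has_bochner_integral lborel \<psi> I"
  shows "(\<lambda>R. integral {- real R - 1 / 2..real R + 1 / 2} \<psi>) \<longlonglongrightarrow> I"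
proof -
  have meas[measurable]: "\<psi> \<in> borel_measurable lborel"
    using borel_measurable_continuous_onI[OF \<psi>] by simp
  have "(\<lambda>R. \<integral>x. indicator {- real R - 1 / 2..real R + 1 / 2} x *\<^sub>R \<psi> x \<partial>lborel) \<longlonglongrightarrow> (\<integral>x. \<psi> x \<partial>lborel)"
  proof (rule integral_dominated_convergence[where w = "\<lambda>x. norm (\<psi> x)"])
    show "integrable lborel (\<lambda>x. norm (\<psi> x))" using I by (simp add: has_bochner_integral_iff)
    show "AE x in lborel. (\<lambda>R. indicator {- real R - 1 / 2..real R + 1 / 2} x *\<^sub>R \<psi> x) \<longlonglongrightarrow> \<psi> x"
    proof (rule AE_I2)
      fix x :: real
      obtain R0 :: nat where R0: "\<bar>x\<bar> \<le> real R0" using real_arch_simple by blast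
      show "(\<lambda>R. indicator {- real R - 1 / 2..real R + 1 / 2} x *\<^sub>R \<psi> x) \<longlonglongrightarrow> \<psi> x"
        by (rule tendsto_eventually, rule eventually_mono[OF eventually_ge_at_top[of R0]])
           (use R0 in \<open>auto simp: indicator_def\<close>)
    qed
  qed (auto simp: indicator_def)
  moreover have "(\<integral>x. indicator {- real R - 1 / 2..real R + 1 / 2} x *\<^sub>R \<psi> x \<partial>lborel)
      = integral {- real R - 1 / 2..real R + 1 / 2} \<psi>" for R
    unfolding set_lebesgue_integral_def[symmetric]
    by (intro set_borel_integral_eq_integral borel_integrable_atLeastAtMost' continuous_on_subset[OF \<psi>]) auto
  ultimately show ?thesis using I by (simp add: has_bochner_integral_iff)
qed

text \<open>Both sides are limits of symmetric partial sums, the form in which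
  \<open>fourier_series_at_0\<close> delivers the dual side. T is the value at 0 of the
  periodization of the Gaussian translated by a.\<close>

lemma poisson_gauss:
  fixes s a :: real and c :: complex
  assumes s: "s > 0"
  obtains T where
    "(\<lambda>R. \<Sum>n\<in>{- int R..int R}. exp (- of_real s * (of_real a + of_int n)\<^sup>2 + c * (of_real a + of_int n))) \<longlonglongrightarrow> T"
    "(\<lambda>M. \<Sum>m\<in>{- int M..int M}. of_real (sqrt (pi / s)) *
        exp (2 * of_real pi * \<i> * of_int m * of_real a + (c - 2 * of_real pi * \<i> * of_int m)\<^sup>2 / (4 * of_real s))) \<longlonglongrightarrow> T"
proof -
  define \<phi> where "\<phi> = (\<lambda>x. exp (- complex_of_real s * x\<^sup>2 + c * x))"
  obtain C where C: "C > 0" "\<And>y n. norm y \<le> 1 + \<bar>a\<bar> \<Longrightarrow> norm (\<phi> (y + of_int n)) \<le> C * exp (- \<bar>real_of_int n\<bar>)"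
    unfolding \<phi>_def using gauss_translate_bound[OF s, of "1 + \<bar>a\<bar>" c] by metis
  define P\<^sub>R where "P\<^sub>R = (\<lambda>R x. \<Sum>n\<in>{- int R..int R}. \<phi> (x + of_real a + of_int n))"
  \<comment> \<open>Pairing the translates by k + 1 and -(k + 1) turns the two-sided sum into an
    ordinary series, to which the Weierstrass M-test applies.\<close>
  define u where "u = (\<lambda>k x. \<phi> (x + of_real a + of_int (int (Suc k))) + \<phi> (x + of_real a + of_int (- int (Suc k))))"
  define P where "P = (\<lambda>x. \<phi> (x + of_real a) + (\<Sum>k. u k x))"
  have P\<^sub>R_eq: "P\<^sub>R R x = \<phi> (x + of_real a) + (\<Sum>k<R. u k x)" for R x
    unfolding P\<^sub>R_def u_def sum_int_symmetric[of "\<lambda>n. \<phi> (x + of_real a + of_int n)"] by simp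
  have "uniform_limit (cball 0 1) (\<lambda>R x. \<Sum>k<R. u k x) (\<lambda>x. \<Sum>k. u k x) sequentially"
  proof (rule Weierstrass_m_test)
    fix k and x :: complex assume x: "x \<in> cball 0 1"
    have y: "norm (x + of_real a) \<le> 1 + \<bar>a\<bar>"
      using x norm_triangle_ineq[of x "of_real a"] by simp
    have "norm (u k x) \<le> C * exp (- \<bar>real_of_int (int (Suc k))\<bar>) + C * exp (- \<bar>real_of_int (- int (Suc k))\<bar>)"
      unfolding u_def by (intro norm_triangle_le add_mono C y)
    also have "\<dots> = 2 * C * exp (- 1) * exp (- 1) ^ k"
      by (simp add: exp_of_nat_mult[symmetric] exp_add[symmetric] algebra_simps)
    finally show "norm (u k x) \<le> 2 * C * exp (- 1) * exp (- 1) ^ k" .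
  next
    show "summable (\<lambda>k. 2 * C * exp (- 1) * exp (- 1) ^ k)"
      by (intro summable_mult summable_geometric) simp
  qed
  hence ulim: "uniform_limit (cball 0 1) P\<^sub>R P sequentially"
    unfolding P\<^sub>R_eq[abs_def] P_def by (intro uniform_limit_add uniform_limit_const)
  have holo: "P\<^sub>R R holomorphic_on A" for R A
    unfolding P\<^sub>R_def \<phi>_def by (intro holomorphic_intros)
  have "P holomorphic_on ball 0 1"
    by (rule holomorphic_uniform_limit[OF _ ulim])
       (auto intro!: always_eventually holo holomorphic_on_imp_continuous_on)
  hence four: "(\<lambda>M. \<Sum>m\<in>{- int M..int M}. integral {- 1 / 2..1 / 2} (\<lambda>x::real. P (of_real x) * fourier_char m (of_real x)))
    \<longlonglongrightarrow> P 0" by (rule fourier_series_at_0)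
  have coeff: "integral {- 1 / 2..1 / 2} (\<lambda>x::real. P (of_real x) * fourier_char m (of_real x))
      = of_real (sqrt (pi / s)) *
        exp (2 * of_real pi * \<i> * of_int m * of_real a + (c - 2 * of_real pi * \<i> * of_int m)\<^sup>2 / (4 * of_real s))"
    for m :: int
  proof -
    define \<psi> where "\<psi> = (\<lambda>x::real. \<phi> (of_real x + of_real a) * fourier_char m (of_real x))"
    have cont: "continuous_on UNIV \<psi>" unfolding \<psi>_def \<phi>_def by (intro continuous_intros)
    have shifted: "\<phi> (of_real x + of_real a + of_int n) * fourier_char m (of_real x) = \<psi> (x + of_int n)" for x n
    proof -
      have "fourier_char m (of_real (x + of_int n)) = fourier_char m (of_real x)"
        unfolding exp_eq by (intro exI[of _ "- m * n"]) (simp add: algebra_simps)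
      thus ?thesis by (simp add: \<psi>_def add_ac)
    qed
    \<comment> \<open>The classical unfolding: uniform convergence exchanges sum and integral, and
      since the character has period 1 the unit intervals tile the line, leaving a Fourier
      transform.\<close>
    have "uniform_limit {- 1 / 2..1 / 2} (\<lambda>R x. P\<^sub>R R (of_real x) * fourier_char m (of_real x))
        (\<lambda>x::real. P (of_real x) * fourier_char m (of_real x)) sequentially"
    proof (rule uniform_limitI)
      fix e :: real assume "e > 0"
      from uniform_limitD[OF ulim this]
      show "\<forall>\<^sub>F R in sequentially. \<forall>x\<in>{- 1 / 2..1 / 2}. dist (P\<^sub>R R (of_real x) * fourier_char m (of_real x))
        (P (of_real x) * fourier_char m (of_real x)) < e"
      proof eventually_elim
        case (elim R)
        show ?case
        proof
          fix x :: real assume "x \<in> {- 1 / 2..1 / 2}"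
          hence "dist (P\<^sub>R R (of_real x)) (P (of_real x)) < e" using elim by auto
          moreover have "norm (fourier_char m (of_real x)) = 1" by simp
          ultimately show "dist (P\<^sub>R R (of_real x) * fourier_char m (of_real x)) (P (of_real x) * fourier_char m (of_real x)) < e"
            unfolding dist_norm left_diff_distrib[symmetric] norm_mult by simp
        qed
      qed
    qed
    then obtain I J where I: "\<And>R. ((\<lambda>x. P\<^sub>R R (of_real x) * fourier_char m (of_real x)) has_integral I R) {- 1 / 2..1 / 2}"
      and J: "((\<lambda>x::real. P (of_real x) * fourier_char m (of_real x)) has_integral J) {- 1 / 2..1 / 2}"
      and IJ: "I \<longlonglongrightarrow> J"
    proof (rule uniform_limit_integral)
      show "continuous_on {- 1 / 2..1 / 2} (\<lambda>x::real. P\<^sub>R R (of_real x) * fourier_char m (of_real x))" for R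
        unfolding P\<^sub>R_def \<phi>_def by (intro continuous_intros)
    qed auto
    have "I R = integral {- real R - 1 / 2..real R + 1 / 2} \<psi>" for R
    proof -
      have "I R = integral {- 1 / 2..1 / 2} (\<lambda>x. \<Sum>n\<in>{- int R..int R}. \<psi> (x + of_int n))"
        using integral_unique[OF I[of R]] unfolding P\<^sub>R_def sum_distrib_right shifted by simp
      also have "\<dots> = (\<Sum>n\<in>{- int R..int R}. integral {- 1 / 2..1 / 2} (\<lambda>x. \<psi> (x + of_int n)))"
        by (intro Henstock_Kurzweil_Integration.integral_sum integrable_continuous_interval
              continuous_on_compose2[OF cont] continuous_intros) auto
      finally show ?thesis unfolding integral_symmetric_unit_intervals[OF cont] .
    qed
    moreover have "has_bochner_integral lborel \<psi> (of_real (sqrt (pi / s)) *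
        exp (2 * of_real pi * \<i> * of_int m * of_real a + (c - 2 * of_real pi * \<i> * of_int m)\<^sup>2 / (4 * of_real s)))"
    proof -
      \<comment> \<open>Recentring at a splits the character into the phase e^(2 pi i m a) and a
        change of the linear coefficient from c to \<open>c'\<close>.\<close>
      define c' where "c' = c - 2 * of_real pi * \<i> * of_int m"
      have "has_bochner_integral lborel (\<lambda>x. exp (- of_real s * (of_real (a + 1 * x))\<^sup>2 + c' * of_real (a + 1 * x)))
           ((of_real (sqrt (pi / s)) * exp (c'\<^sup>2 / (4 * of_real s))) /\<^sub>R \<bar>1\<bar>)"
        by (subst lborel_has_bochner_integral_real_affine_iff[symmetric,
              where f = "\<lambda>x. exp (- of_real s * (of_real x)\<^sup>2 + c' * of_real x)"])
           (use gauss_fourier_transform[OF s, of c'] in auto)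
      hence "has_bochner_integral lborel (\<lambda>x. exp (2 * of_real pi * \<i> * of_int m * of_real a) *
          exp (- of_real s * (of_real (a + 1 * x))\<^sup>2 + c' * of_real (a + 1 * x)))
           (exp (2 * of_real pi * \<i> * of_int m * of_real a) * ((of_real (sqrt (pi / s)) * exp (c'\<^sup>2 / (4 * of_real s))) /\<^sub>R \<bar>1\<bar>))"
        by (rule has_bochner_integral_mult_right)
      also have "(\<lambda>x. exp (2 * of_real pi * \<i> * of_int m * of_real a) *
          exp (- of_real s * (of_real (a + 1 * x))\<^sup>2 + c' * of_real (a + 1 * x))) = \<psi>"
        unfolding \<psi>_def \<phi>_def exp_add[symmetric]
        by (intro ext arg_cong[of _ _ exp]) (simp add: c'_def algebra_simps)
      also have "exp (2 * of_real pi * \<i> * of_int m * of_real a) * ((of_real (sqrt (pi / s)) * exp (c'\<^sup>2 / (4 * of_real s))) /\<^sub>R \<bar>1\<bar>)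
        = of_real (sqrt (pi / s)) * exp (2 * of_real pi * \<i> * of_int m * of_real a + c'\<^sup>2 / (4 * of_real s))"
        by (simp add: exp_add)
      finally show ?thesis by (simp add: c'_def)
    qed
    ultimately have "I \<longlonglongrightarrow> of_real (sqrt (pi / s)) *
        exp (2 * of_real pi * \<i> * of_int m * of_real a + (c - 2 * of_real pi * \<i> * of_int m)\<^sup>2 / (4 * of_real s))"
      using integral_symmetric_tendsto_lborel[OF cont] by presburger
    from LIMSEQ_unique[OF IJ this] show ?thesis unfolding integral_unique[OF J] .
  qed
  show ?thesis
  proof (rule that)
    show "(\<lambda>R. \<Sum>n\<in>{- int R..int R}. exp (- of_real s * (of_real a + of_int n)\<^sup>2 + c * (of_real a + of_int n))) \<longlonglongrightarrow> P 0"
      using tendsto_uniform_limitI[OF ulim, of 0] unfolding P\<^sub>R_def \<phi>_def by (simp only: mem_ball_imp_mem_cball centre_in_ball zero_less_one add_0)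
  qed (use four[unfolded coeff] in simp)
qed

section \<open>The sum outside the unit disc\<close>

text \<open>Poisson summation works with a logarithm c of w, as w^(n + a) depends on a choice; the
  factor e^(c a) isolates that choice and leaves an integer power.\<close>

lemma gauss_term_eq:
  fixes c :: complex
  shows "exp (- of_real s * (of_real a + of_int n)\<^sup>2 + c * (of_real a + of_int n))
     = exp (c * of_real a) * (exp c powi n * of_real (exp (- s * (real_of_int n + a)\<^sup>2)))"
proof -
  have "exp c powi n = exp (of_int n * c)" by (simp add: exp_power_int)
  moreover have "complex_of_real (exp (- s * (real_of_int n + a)\<^sup>2)) = exp (- of_real s * (of_int n + of_real a)\<^sup>2)"
    by (simp flip: exp_of_real)
  ultimately show ?thesis by (simp add: exp_add[symmetric] algebra_simps)
qed

lemma summable_shifted_gauss: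
  fixes w :: complex
  assumes s: "s > 0" and w: "w \<noteq> 0"
  shows "summable (\<lambda>n. w ^ n * of_real (exp (- s * (real n + a)\<^sup>2)))"
proof -
  obtain c where c: "exp c = w" using w exp_Ln by blast
  obtain C where C: "C > 0" "\<And>y n. norm y \<le> \<bar>a\<bar> \<Longrightarrow>
     norm (exp (- of_real s * (y + of_int n)\<^sup>2 + c * (y + of_int n))) \<le> C * exp (- \<bar>real_of_int n\<bar>)"
    by (rule gauss_translate_bound[OF s, of "\<bar>a\<bar>" c]) blast
  have "norm (exp (c * of_real a) * (w ^ n * of_real (exp (- s * (real n + a)\<^sup>2)))) \<le> C * exp (- 1) ^ n" for n
    using C(2)[of "of_real a" "int n"] unfolding gauss_term_eq c
    by (simp add: exp_of_nat_mult[symmetric])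
  hence "summable (\<lambda>n. exp (c * of_real a) * (w ^ n * of_real (exp (- s * (real n + a)\<^sup>2))))"
    by (intro summable_comparison_test'[OF summable_mult[OF summable_geometric[of "exp (- 1)"]], of 0 _ C]) auto
  thus ?thesis by (subst (asm) summable_cmult_iff) auto
qed

text \<open>For n = -(k + 1) one has (n + a)^2 = (k + 1 - a)^2 and w^n = w^(-1) w^(-k), so the
  negative half is again a one-sided sum, now for 1/w and 1 - a.\<close>

lemma shifted_gauss_sum_reflect:
  fixes c :: complex
  assumes s: "s > 0"
    and T: "(\<lambda>R. \<Sum>n\<in>{- int R..int R}. exp (- of_real s * (of_real a + of_int n)\<^sup>2 + c * (of_real a + of_int n))) \<longlonglongrightarrow> T"
  shows "T = exp (c * of_real a) * (shifted_gauss_sum (exp c) a s + inverse (exp c) * shifted_gauss_sum (inverse (exp c)) (1 - a) s)"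
proof -
  define h where "h = (\<lambda>n. exp (- of_real s * (of_real a + of_int n)\<^sup>2 + c * (of_real a + of_int n)))"
  have pos: "(\<lambda>n. h (int n)) sums (exp (c * of_real a) * shifted_gauss_sum (exp c) a s)"
    using sums_mult[OF summable_sums[OF summable_shifted_gauss[OF s, of "exp c" a]], of "exp (c * of_real a)"]
    unfolding h_def gauss_term_eq shifted_gauss_sum_def by simp
  have neg: "(\<lambda>n. h (- int (Suc n))) sums (exp (c * of_real a) * (inverse (exp c) * shifted_gauss_sum (inverse (exp c)) (1 - a) s))"
  proof -
    have "h (- int (Suc n)) = exp (c * of_real a) * (inverse (exp c) *
        (inverse (exp c) ^ n * of_real (exp (- s * (real n + (1 - a))\<^sup>2))))" for n
    proof -
      have "(real_of_int (- int (Suc n)) + a)\<^sup>2 = (real n + (1 - a))\<^sup>2"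
        by (simp add: power2_eq_square algebra_simps)
      moreover have "exp c powi (- int (Suc n)) = inverse (exp c) * inverse (exp c) ^ n"
        unfolding power_int_minus power_int_of_nat by (simp add: power_inverse)
      ultimately show ?thesis unfolding h_def gauss_term_eq by simp
    qed
    thus ?thesis
      using sums_mult[OF sums_mult[OF summable_sums[OF summable_shifted_gauss[OF s, of "inverse (exp c)" "1 - a"]], of "inverse (exp c)"],
              of "exp (c * of_real a)"]
      unfolding shifted_gauss_sum_def by simp
  qed
  have "(\<lambda>R. (\<Sum>k<Suc R. h (int k)) + (\<Sum>k<R. h (- int (Suc k)))) \<longlonglongrightarrow>
      exp (c * of_real a) * shifted_gauss_sum (exp c) a s
      + exp (c * of_real a) * (inverse (exp c) * shifted_gauss_sum (inverse (exp c)) (1 - a) s)"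
    using pos neg unfolding sums_def by (intro tendsto_add LIMSEQ_Suc)
  moreover have "(\<Sum>n\<in>{- int R..int R}. h n) = (\<Sum>k<Suc R. h (int k)) + (\<Sum>k<R. h (- int (Suc k)))" for R
    unfolding sum_int_symmetric sum.lessThan_Suc_shift sum.distrib by (simp add: add.assoc)
  ultimately show ?thesis using LIMSEQ_unique[OF T] unfolding h_def by (simp add: distrib_left)
qed

text \<open>The difference of squares is Re ((m - X - i Y)^2). Its ratio to 1 + m^2 tends to 1, so
  it falls below 1/4 for finitely many m only, and the minimum over these is positive because the
  exclusion is strict.\<close>

lemma square_diff_lower_bound:
  fixes X Y :: real
  obtains \<delta> where "\<delta> > 0"
    "\<And>m. \<bar>real_of_int m - X\<bar> > \<bar>Y\<bar> \<Longrightarrow> (real_of_int m - X)\<^sup>2 - Y\<^sup>2 \<ge> \<delta> * (1 + (real_of_int m)\<^sup>2)"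
proof -
  define q where "q = (\<lambda>m. (real_of_int m - X)\<^sup>2 - Y\<^sup>2)"
  define B where "B = {m. \<bar>real_of_int m - X\<bar> > \<bar>Y\<bar> \<and> q m < (1 + (real_of_int m)\<^sup>2) / 4}"
  \<comment> \<open>By m^2 \<le> 2 (m - X)^2 + 2 X^2, membership in \<open>B\<close> forces m^2 < 1
    + 4 X^2 + 4 Y^2.\<close>
  obtain K :: nat where K: "1 + 4 * X\<^sup>2 + 4 * Y\<^sup>2 \<le> real K" using real_arch_simple by blast
  have "B \<subseteq> {- int K..int K}"
  proof
    fix m assume "m \<in> B"
    hence "4 * (real_of_int m - X)\<^sup>2 - 4 * Y\<^sup>2 < 1 + (real_of_int m)\<^sup>2" by (simp add: B_def q_def field_simps)
    moreover have "(real_of_int m)\<^sup>2 \<le> 2 * (real_of_int m - X)\<^sup>2 + 2 * X\<^sup>2"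
      using sum_squares_ge_zero[of "real_of_int m - 2 * X" 0] by (simp add: power2_eq_square algebra_simps)
    ultimately have "(real_of_int m)\<^sup>2 < real K" using K by linarith
    hence "m\<^sup>2 < int K" by (metis of_int_less_iff of_int_of_nat_eq of_int_power)
    moreover have "\<bar>m\<bar> * 1 \<le> \<bar>m\<bar> * \<bar>m\<bar>" by (cases "m = 0", simp, rule mult_left_mono) auto
    hence "\<bar>m\<bar> \<le> m\<^sup>2" by (simp add: power2_eq_square)
    ultimately show "m \<in> {- int K..int K}" by auto
  qed
  hence fin: "finite B" by (rule finite_subset) simp
  define S where "S = insert (1 / 4) ((\<lambda>m. q m / (1 + (real_of_int m)\<^sup>2)) ` B)"
  have S: "finite S" "S \<noteq> {}" using fin by (auto simp: S_def)
  have pos: "q m > 0" if "\<bar>real_of_int m - X\<bar> > \<bar>Y\<bar>" for m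
    using that abs_le_square_iff[of "real_of_int m - X" Y] unfolding q_def by linarith
  have p1: "1 + x\<^sup>2 > 0" for x :: real by (simp add: add_pos_nonneg)
  show ?thesis
  proof (rule that[of "Min S"])
    show "Min S > 0" unfolding Min_gr_iff[OF S] by (auto simp: S_def B_def pos p1)
    fix m assume m: "\<bar>real_of_int m - X\<bar> > \<bar>Y\<bar>"
    show "(real_of_int m - X)\<^sup>2 - Y\<^sup>2 \<ge> Min S * (1 + (real_of_int m)\<^sup>2)"
    proof (cases "m \<in> B")
      case True
      hence "Min S \<le> q m / (1 + (real_of_int m)\<^sup>2)" using S by (intro Min_le) (auto simp: S_def)
      thus ?thesis using p1[of "real_of_int m"] by (simp add: q_def pos_le_divide_eq)
    next
      case False
      have "Min S \<le> 1 / 4" using S by (intro Min_le) (auto simp: S_def)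
      hence "Min S * (1 + (real_of_int m)\<^sup>2) \<le> 1 / 4 * (1 + (real_of_int m)\<^sup>2)"
        by (intro mult_right_mono) (use p1[of "real_of_int m"] in auto)
      also have "\<dots> \<le> q m" using False m by (auto simp: B_def)
      finally show ?thesis by (simp add: q_def)
    qed
  qed
qed

lemma sum_int_inverse_square_bounded:
  "(\<Sum>m\<in>{- int M..int M}. 1 / (1 + (real_of_int m)\<^sup>2)) \<le> 1 + 2 * (\<Sum>n. 1 / (1 + (real n)\<^sup>2))"
proof -
  have "(\<Sum>k<M. 1 / (1 + (real (Suc k))\<^sup>2)) \<le> (\<Sum>k<Suc M. 1 / (1 + (real k)\<^sup>2))"
    unfolding sum.lessThan_Suc_shift by simp
  also have "\<dots> \<le> (\<Sum>n. 1 / (1 + (real n)\<^sup>2))"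
    by (intro sum_le_suminf summable_inverse_one_plus_square) (auto simp: add_pos_nonneg less_imp_le)
  finally have "(\<Sum>k<M. 1 / (1 + (real (Suc k))\<^sup>2)) \<le> (\<Sum>n. 1 / (1 + (real n)\<^sup>2))" .
  moreover have "(real_of_int (- int k))\<^sup>2 = (real k)\<^sup>2" for k by simp
  ultimately show ?thesis
    unfolding sum_int_symmetric sum.distrib of_int_of_nat_eq by (simp only:) simp
qed

text \<open>Off the exceptional set the exponentials are bounded by e^(-\<delta> (1 + m^2) / s),
  smaller than any power of s. The constant depends neither on a nor on M, so the estimate passes to
  the limit in M.\<close>

lemma dual_theta_tail:
  fixes \<zeta> :: complex and N :: nat
  obtains C where "\<And>s a M. 0 < s \<Longrightarrow> s \<le> 1 \<Longrightarrow>
    norm (\<Sum>m\<in>{- int M..int M} - {m. \<bar>real_of_int m - Re \<zeta>\<bar> \<le> \<bar>Im \<zeta>\<bar>}.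
       of_real (sqrt (pi / s)) * exp (2 * of_real pi * \<i> * of_int m * of_real a - of_real (pi\<^sup>2) * (\<zeta> - of_int m)\<^sup>2 / of_real s))
      \<le> C * s ^ (N + 1)"
proof -
  obtain \<delta> where \<delta>: "\<delta> > 0" "\<And>m. \<bar>real_of_int m - Re \<zeta>\<bar> > \<bar>Im \<zeta>\<bar> \<Longrightarrow>
      (real_of_int m - Re \<zeta>)\<^sup>2 - (Im \<zeta>)\<^sup>2 \<ge> \<delta> * (1 + (real_of_int m)\<^sup>2)"
    by (rule square_diff_lower_bound[of "Im \<zeta>" "Re \<zeta>"]) blast
  define D where "D = sqrt pi * (fact (N + 2) / \<delta> ^ (N + 2))"
  define \<sigma> where "\<sigma> = (\<Sum>n. 1 / (1 + (real n)\<^sup>2))"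
  have D0: "D \<ge> 0" using \<delta> by (simp add: D_def)
  show ?thesis
  proof (rule that[of "D * (1 + 2 * \<sigma>)"])
    fix s a :: real and M :: nat assume s: "0 < s" "s \<le> 1"
    define A where "A = {m. \<bar>real_of_int m - Re \<zeta>\<bar> \<le> \<bar>Im \<zeta>\<bar>}"
    have bound: "norm (of_real (sqrt (pi / s)) * exp (2 * of_real pi * \<i> * of_int m * of_real a - of_real (pi\<^sup>2) * (\<zeta> - of_int m)\<^sup>2 / of_real s))
        \<le> D * s ^ (N + 1) * (1 / (1 + (real_of_int m)\<^sup>2))" if m: "m \<notin> A" for m
    proof -
      define e where "e = 1 + (real_of_int m)\<^sup>2"
      have e: "e \<ge> 1" by (simp add: e_def)
      define x where "x = \<delta> * e / s"
      have x: "x > 0" using \<delta> e s by (simp add: x_def)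
      have "Re (2 * of_real pi * \<i> * of_int m * of_real a - of_real (pi\<^sup>2) * (\<zeta> - of_int m)\<^sup>2 / of_real s)
          = - (pi\<^sup>2 * ((real_of_int m - Re \<zeta>)\<^sup>2 - (Im \<zeta>)\<^sup>2) / s)"
        by (simp add: Re_divide_of_real power2_eq_square algebra_simps)
      also have "\<dots> \<le> - x"
      proof -
        have "1 * (\<delta> * e) \<le> pi\<^sup>2 * ((real_of_int m - Re \<zeta>)\<^sup>2 - (Im \<zeta>)\<^sup>2)"
        proof (rule mult_mono)
          show "1 \<le> pi\<^sup>2" using pi_ge_two by (intro one_le_power) auto
          show "\<delta> * e \<le> (real_of_int m - Re \<zeta>)\<^sup>2 - (Im \<zeta>)\<^sup>2" using \<delta>(2)[of m] m by (auto simp: A_def e_def)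
        qed (use \<delta> e in auto)
        thus ?thesis using s by (simp add: x_def divide_right_mono)
      qed
      finally have "norm (exp (2 * of_real pi * \<i> * of_int m * of_real a - of_real (pi\<^sup>2) * (\<zeta> - of_int m)\<^sup>2 / of_real s)) \<le> exp (- x)"
        unfolding norm_exp_eq_Re by simp
      \<comment> \<open>The power N + 2 exceeds the target by one because sqrt (pi / s) is estimated
        by sqrt pi / s, which consumes a factor s. Of e^(N + 2) in the denominator a single
        \<open>e\<close> is kept, enough for summability in m.\<close>
      also have "exp (- x) \<le> fact (N + 2) / x ^ (N + 2)"
        using power_le_fact_exp[of x "N + 2"] x by (simp add: exp_minus field_simps)
      also have "\<dots> = fact (N + 2) / \<delta> ^ (N + 2) * s ^ (N + 2) / e ^ (N + 2)"
        by (simp add: x_def power_mult_distrib power_divide)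
      also have "\<dots> \<le> fact (N + 2) / \<delta> ^ (N + 2) * s ^ (N + 2) / e"
        using e \<delta> s by (intro divide_left_mono self_le_power) auto
      finally have "norm (of_real (sqrt (pi / s)) * exp (2 * of_real pi * \<i> * of_int m * of_real a - of_real (pi\<^sup>2) * (\<zeta> - of_int m)\<^sup>2 / of_real s))
          \<le> (sqrt pi / s) * (fact (N + 2) / \<delta> ^ (N + 2) * s ^ (N + 2) / e)"
        unfolding norm_mult
      proof (intro mult_mono)
        have "s \<le> sqrt s" using s by (intro real_le_rsqrt) (auto simp: power2_eq_square mult_le_one mult_left_le)
        thus "norm (complex_of_real (sqrt (pi / s))) \<le> sqrt pi / s"
          using s unfolding norm_of_real by (simp add: real_sqrt_divide divide_left_mono)
      qed (use s in auto)
      also have "\<dots> = D * s ^ (N + 1) * (1 / e)" using s by (simp add: D_def)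
      finally show ?thesis by (simp add: e_def)
    qed
    have "norm (\<Sum>m\<in>{- int M..int M} - A.
       of_real (sqrt (pi / s)) * exp (2 * of_real pi * \<i> * of_int m * of_real a - of_real (pi\<^sup>2) * (\<zeta> - of_int m)\<^sup>2 / of_real s))
       \<le> (\<Sum>m\<in>{- int M..int M} - A. D * s ^ (N + 1) * (1 / (1 + (real_of_int m)\<^sup>2)))"
      by (intro sum_norm_le bound) auto
    also have "\<dots> \<le> (\<Sum>m\<in>{- int M..int M}. D * s ^ (N + 1) * (1 / (1 + (real_of_int m)\<^sup>2)))"
      using D0 s by (intro sum_mono2) (auto intro!: mult_nonneg_nonneg divide_nonneg_nonneg add_nonneg_nonneg)
    also have "\<dots> \<le> D * s ^ (N + 1) * (1 + 2 * \<sigma>)"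
      unfolding sum_distrib_left[symmetric] \<sigma>_def using D0 s
      by (intro mult_left_mono sum_int_inverse_square_bounded) auto
    finally show "norm (\<Sum>m\<in>{- int M..int M} - {m. \<bar>real_of_int m - Re \<zeta>\<bar> \<le> \<bar>Im \<zeta>\<bar>}.
       of_real (sqrt (pi / s)) * exp (2 * of_real pi * \<i> * of_int m * of_real a - of_real (pi\<^sup>2) * (\<zeta> - of_int m)\<^sup>2 / of_real s))
      \<le> D * (1 + 2 * \<sigma>) * s ^ (N + 1)"
      unfolding A_def by (simp only: mult_ac)
  qed
qed

text \<open>The formal counterpart of the reflection n to -n - 1, resting on 1 - e^X / w = -(e^X /
  w) (1 - w e^(-X)).\<close>

lemma fps_reflect_generating:
  fixes b :: "complex fps"
  assumes b: "b * (1 - fps_const w * fps_exp 1) = fps_X * fps_exp a" and w: "w \<noteq> 0"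
  shows "fps_const w * (b oo (fps_const (- 1) * fps_X)) * (1 - fps_const (inverse w) * fps_exp 1)
    = fps_X * fps_exp (1 - a)"
proof -
  define c where "c = fps_const (- 1) * (fps_X :: complex fps)"
  have c0: "fps_nth c 0 = 0" by (simp add: c_def)
  have cm: "c = - fps_X" by (simp add: c_def fps_eq_iff)
  have ec: "fps_exp x oo c = fps_exp (- x)" for x :: complex by (simp add: c_def fps_exp_compose_linear)
  have "(b * (1 - fps_const w * fps_exp 1)) oo c = (b oo c) * (1 - fps_const w * fps_exp (- 1))"
    by (simp add: fps_compose_mult_distrib[OF c0] fps_compose_sub_distrib)
       (simp add: c_def fps_exp_compose_linear)
  moreover have "(fps_X * fps_exp a) oo c = - fps_X * fps_exp (- a)"
    by (simp add: fps_compose_mult_distrib[OF c0] ec) (simp add: cm)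
  ultimately have comp: "(b oo c) * (1 - fps_const w * fps_exp (- 1)) = - fps_X * fps_exp (- a)"
    using b by simp
  have "1 - fps_const (inverse w) * fps_exp 1
      = - (fps_const (inverse w) * fps_exp 1) * (1 - fps_const w * fps_exp (- 1))"
  proof -
    have "fps_const (inverse w) * fps_exp 1 * (fps_const w * fps_exp (- 1))
        = fps_const (inverse w * w) * (fps_exp 1 * fps_exp (- 1))"
      by (simp add: mult_ac flip: fps_const_mult)
    also have "\<dots> = 1" using w by (simp flip: fps_exp_add_mult)
    finally show ?thesis by (simp add: algebra_simps)
  qed
  hence "fps_const w * (b oo c) * (1 - fps_const (inverse w) * fps_exp 1)
      = - (fps_const w * fps_const (inverse w) * fps_exp 1) * ((b oo c) * (1 - fps_const w * fps_exp (- 1)))"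
    by (simp only: mult_ac mult_minus_left mult_minus_right)
  also have "\<dots> = fps_X * (fps_exp 1 * fps_exp (- a))"
    unfolding comp using w by (simp add: mult_ac)
  also have "fps_exp 1 * fps_exp (- a) = fps_exp (1 - a)" by (simp flip: fps_exp_add_mult)
  finally show ?thesis by (simp add: c_def)
qed

text \<open>The sum is the theta series, freed of its factor e^(c a), minus 1/w times the reflected
  sum, and the latter falls under |w| \<le> 1. The reflected odd coefficients are -w times those of
  b, so the subtraction restores the expansion in b with its own sign.\<close>

lemma shifted_gauss_sum_asymp_large:
  fixes b :: "complex fps" and \<zeta> :: complex and a :: real and N :: nat
  defines "w \<equiv> exp (2 * of_real pi * \<i> * \<zeta>)"
  assumes b: "b * (1 - fps_const w * fps_exp 1) = fps_X * fps_exp (of_real a)"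
    and w: "norm w > 1"
  obtains C where "\<And>s. 0 < s \<Longrightarrow> s \<le> 1 \<Longrightarrow>
     norm (shifted_gauss_sum w a s - (exp (- (2 * of_real pi * \<i> * \<zeta> * of_real a)) *
         (\<Sum>m | \<bar>real_of_int m - Re \<zeta>\<bar> \<le> \<bar>Im \<zeta>\<bar>. of_real (sqrt (pi / s)) *
            exp (2 * of_real pi * \<i> * of_int m * of_real a - of_real (pi\<^sup>2) * (\<zeta> - of_int m)\<^sup>2 / of_real s))
       + (\<Sum>k=0..N. fps_nth b (2 * k + 1) * of_real ((- s) ^ k * fact (2 * k) / fact k)))) \<le> C * s ^ (N + 1)"
proof -
  define c where "c = 2 * of_real pi * \<i> * \<zeta>"
  define A where "A = {m. \<bar>real_of_int m - Re \<zeta>\<bar> \<le> \<bar>Im \<zeta>\<bar>}"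
  define t where "t = (\<lambda>s m. of_real (sqrt (pi / s)) *
            exp (2 * of_real pi * \<i> * of_int m * of_real a - of_real (pi\<^sup>2) * (\<zeta> - of_int m)\<^sup>2 / complex_of_real s))"
  define b' where "b' = fps_const w * (b oo (fps_const (- 1) * fps_X))"
  have w0: "w \<noteq> 0" "w = exp c" by (auto simp: w_def c_def)
  have b': "b' * (1 - fps_const (inverse w) * fps_exp 1) = fps_X * fps_exp (of_real (1 - a))"
    unfolding b'_def using fps_reflect_generating[OF b w0(1)] by simp
  have b'_nth: "fps_nth b' n = w * ((- 1) ^ n * fps_nth b n)" for n
    by (simp add: b'_def fps_compose_linear)
  \<comment> \<open>Constant terms give (1 - w) b_0 = 0 with w \<noteq> 1, so the singular term of
    order s^(-1/2) is absent.\<close>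
  have "fps_nth (b * (1 - fps_const w * fps_exp 1)) 0 = 0" unfolding b by simp
  hence b0: "fps_nth b 0 = 0" using w by auto
  define X where "X = (\<lambda>s. \<Sum>k=0..N. fps_nth b (2 * k + 1) * complex_of_real ((- s) ^ k * fact (2 * k) / fact k))"
  have "norm (inverse w) \<le> 1" using w by (simp add: norm_inverse inverse_le_1_iff)
  then obtain C1 where C1: "\<And>s. 0 < s \<Longrightarrow> s \<le> 1 \<Longrightarrow>
     norm (shifted_gauss_sum (inverse w) (1 - a) s - (- fps_nth b' 0 * of_real (sqrt pi / (2 * sqrt s))
       + (\<Sum>k=0..N. fps_nth b' (2 * k + 1) * of_real ((- s) ^ k * fact (2 * k) / fact k)))) \<le> C1 * s ^ (N + 1)"
    by (rule shifted_gauss_sum_asymp[OF b', of N]) blast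
  have C1': "norm (shifted_gauss_sum (inverse w) (1 - a) s + w * X s) \<le> C1 * s ^ (N + 1)" if "0 < s" "s \<le> 1" for s
    using C1[OF that] unfolding b'_nth b0 X_def sum_distrib_left by (simp add: sum_negf mult_ac)
  obtain C2 where C2: "\<And>s a M. 0 < s \<Longrightarrow> s \<le> 1 \<Longrightarrow>
    norm (\<Sum>m\<in>{- int M..int M} - {m. \<bar>real_of_int m - Re \<zeta>\<bar> \<le> \<bar>Im \<zeta>\<bar>}.
       of_real (sqrt (pi / s)) * exp (2 * of_real pi * \<i> * of_int m * of_real a - of_real (pi\<^sup>2) * (\<zeta> - of_int m)\<^sup>2 / of_real s))
      \<le> C2 * s ^ (N + 1)"
    by (rule dual_theta_tail[of \<zeta> N]) blast
  obtain K :: nat where K: "\<bar>Re \<zeta>\<bar> + \<bar>Im \<zeta>\<bar> \<le> real K" using real_arch_simple by blast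
  have A_sub: "A \<subseteq> {- int M..int M}" if "M \<ge> K" for M
  proof
    fix m assume "m \<in> A"
    hence "\<bar>real_of_int m\<bar> \<le> real M" using K that unfolding A_def by simp
    thus "m \<in> {- int M..int M}" by auto
  qed
  have "norm (shifted_gauss_sum w a s - (exp (- (c * of_real a)) * (\<Sum>m\<in>A. t s m) + X s))
      \<le> (norm (exp (- (c * of_real a))) * C2 + norm (inverse w) * C1) * s ^ (N + 1)" if s: "0 < s" "s \<le> 1" for s
  proof -
    obtain T where T1: "(\<lambda>R. \<Sum>n\<in>{- int R..int R}. exp (- of_real s * (of_real a + of_int n)\<^sup>2 + c * (of_real a + of_int n))) \<longlonglongrightarrow> T"
      and T2: "(\<lambda>M. \<Sum>m\<in>{- int M..int M}. of_real (sqrt (pi / s)) *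
        exp (2 * of_real pi * \<i> * of_int m * of_real a + (c - 2 * of_real pi * \<i> * of_int m)\<^sup>2 / (4 * of_real s))) \<longlonglongrightarrow> T"
      by (rule poisson_gauss[OF s(1)]) blast
    have "(c - 2 * of_real pi * \<i> * of_int m)\<^sup>2 / (4 * of_real s) = - (of_real (pi\<^sup>2) * (\<zeta> - of_int m)\<^sup>2 / of_real s)" for m
    proof -
      have "c - 2 * of_real pi * \<i> * of_int m = 2 * of_real pi * \<i> * (\<zeta> - of_int m)" by (simp add: c_def algebra_simps)
      thus ?thesis by (simp add: power_mult_distrib)
    qed
    hence T2': "(\<lambda>M. \<Sum>m\<in>{- int M..int M}. t s m) \<longlonglongrightarrow> T" using T2 by (simp add: t_def)
    have TA: "norm (T - (\<Sum>m\<in>A. t s m)) \<le> C2 * s ^ (N + 1)"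
    proof (rule tendsto_upperbound)
      show "(\<lambda>M. norm ((\<Sum>m\<in>{- int M..int M}. t s m) - (\<Sum>m\<in>A. t s m))) \<longlonglongrightarrow> norm (T - (\<Sum>m\<in>A. t s m))"
        by (intro tendsto_norm tendsto_diff T2' tendsto_const)
      show "\<forall>\<^sub>F M in sequentially. norm ((\<Sum>m\<in>{- int M..int M}. t s m) - (\<Sum>m\<in>A. t s m)) \<le> C2 * s ^ (N + 1)"
        using eventually_ge_at_top[of K]
      proof eventually_elim
        case (elim M)
        have "(\<Sum>m\<in>{- int M..int M}. t s m) - (\<Sum>m\<in>A. t s m) = (\<Sum>m\<in>{- int M..int M} - A. t s m)"
          by (rule sum_diff[OF _ A_sub[OF elim], symmetric]) simp
        thus ?case using C2[OF s, where M = M and a = a] by (simp add: t_def A_def)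
      qed
    qed auto
    have "T = exp (c * of_real a) * (shifted_gauss_sum w a s + inverse w * shifted_gauss_sum (inverse w) (1 - a) s)"
      using shifted_gauss_sum_reflect[OF s(1) T1] by (simp add: w0)
    hence "exp (- (c * of_real a)) * T = shifted_gauss_sum w a s + inverse w * shifted_gauss_sum (inverse w) (1 - a) s"
      by (simp add: exp_minus)
    hence "shifted_gauss_sum w a s - (exp (- (c * of_real a)) * (\<Sum>m\<in>A. t s m) + X s)
        = exp (- (c * of_real a)) * (T - (\<Sum>m\<in>A. t s m))
          - inverse w * (shifted_gauss_sum (inverse w) (1 - a) s + w * X s)"
      using w0 by (simp add: algebra_simps)
    hence "norm (shifted_gauss_sum w a s - (exp (- (c * of_real a)) * (\<Sum>m\<in>A. t s m) + X s))
        \<le> norm (exp (- (c * of_real a))) * norm (T - (\<Sum>m\<in>A. t s m))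
          + norm (inverse w) * norm (shifted_gauss_sum (inverse w) (1 - a) s + w * X s)"
      using norm_triangle_ineq4 norm_mult by metis
    also have "\<dots> \<le> norm (exp (- (c * of_real a))) * (C2 * s ^ (N + 1)) + norm (inverse w) * (C1 * s ^ (N + 1))"
      by (intro add_mono mult_left_mono TA C1' s) auto
    finally show ?thesis by (simp add: algebra_simps)
  qed
  thus ?thesis unfolding c_def A_def t_def X_def by (rule that)
qed

section \<open>Taylor coefficients of the sine quotient\<close>

lemma deriv_translate: "deriv (\<lambda>x. f (z + x)) = (\<lambda>x. deriv f (z + x))"
proof
  fix x
  show "deriv (\<lambda>x. f (z + x)) x = deriv f (z + x)"
    using higher_deriv_shift_0[of 1 "\<lambda>x. f (z + x)" x] higher_deriv_shift_0[of 1 f "z + x"]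
    by (simp add: o_def add.assoc)
qed

text \<open>\<open>has_fps_expansion\<close> is centred at 0, hence the translate by z. Carrying the
  whole expansion through the induction, not only its value at 0, makes each \<open>Dz\<close> a
  formal derivative.\<close>

lemma Dz_funpow_eq_fps_nth:
  assumes "(\<lambda>x. f (z + x)) has_fps_expansion H"
  shows "(Dz ^^ n) f z = (1 / (2 * of_real pi * \<i>)) ^ n * (fact n * fps_nth H n)"
proof -
  define \<kappa> where "\<kappa> = 1 / (2 * of_real pi * \<i>)"
  have "(\<lambda>x. (Dz ^^ n) f (z + x)) has_fps_expansion (fps_const (\<kappa> ^ n) * (fps_deriv ^^ n) H)"
  proof (induction n)
    case 0
    show ?case using assms by simp
  next
    case (Suc n)
    have "(\<lambda>x. \<kappa> * deriv (\<lambda>x. (Dz ^^ n) f (z + x)) x) has_fps_expansion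
        (fps_const \<kappa> * fps_deriv (fps_const (\<kappa> ^ n) * (fps_deriv ^^ n) H))"
      by (intro has_fps_expansion_cmult_left has_fps_expansion_deriv Suc)
    moreover have "(\<lambda>x. (Dz ^^ Suc n) f (z + x)) = (\<lambda>x. \<kappa> * deriv (\<lambda>x. (Dz ^^ n) f (z + x)) x)"
      unfolding deriv_translate by (simp add: Dz_def \<kappa>_def)
    moreover have "fps_const \<kappa> * fps_deriv (fps_const (\<kappa> ^ n) * (fps_deriv ^^ n) H)
        = fps_const (\<kappa> ^ Suc n) * (fps_deriv ^^ Suc n) H"
      by (simp flip: fps_const_mult add: mult.assoc)
    ultimately show ?case by (simp only:)
  qed
  from has_fps_expansion_imp_0_eq_fps_nth_0[OF this]
  have "(Dz ^^ n) f z = \<kappa> ^ n * fps_nth ((fps_deriv ^^ n) H) 0" by simp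
  also have "fps_nth ((fps_deriv ^^ n) H) 0 = fact n * fps_nth H n"
    by (induction n arbitrary: H) (simp_all add: funpow_Suc_right algebra_simps del: funpow.simps)
  finally show ?thesis by (simp add: \<kappa>_def)
qed

text \<open>Up to sign the exponential generating function of the Apostol-Bernoulli polynomials,
  formally X times the sum of w^n e^((n + a) X). The \<open>inverse\<close> is genuine only for w
  \<noteq> 1; at w = 1 the Bernoulli polynomials take over.\<close>

definition lerch_fps :: "complex \<Rightarrow> complex \<Rightarrow> complex fps" where
  "lerch_fps w a = fps_X * fps_exp a * inverse (1 - fps_const w * fps_exp 1)"

lemma lerch_fps_mult:
  assumes "w \<noteq> 1"
  shows "lerch_fps w a * (1 - fps_const w * fps_exp 1) = fps_X * fps_exp a"
proof -
  have "inverse (1 - fps_const w * fps_exp 1) * (1 - fps_const w * fps_exp 1) = (1 :: complex fps)"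
    using assms by (intro inverse_mult_eq_1) auto
  thus ?thesis by (simp add: lerch_fps_def mult.assoc)
qed

lemma lerch_fps_nth_0 [simp]: "fps_nth (lerch_fps w a) 0 = 0"
  unfolding lerch_fps_def mult.assoc fps_X_mult_nth by simp

text \<open>With a = d / l all exponentials in the quotient depend on 2 pi i l x alone, so its
  Taylor series at z is a rescaled difference of two \<open>lerch_fps\<close> with the factor X
  removed. Hence the index \<open>Suc n\<close> and, once \<open>Dz\<close> has cancelled 2 pi i,
  the factor l^n.\<close>

lemma Dz_funpow_sin_quotient:
  fixes d :: rat and l :: nat and z :: complex
  assumes l: "l \<ge> 1" and w: "epow (of_nat l) z \<noteq> 1"
  shows "2 * \<i> * (Dz ^^ n) (\<lambda>w. sin (2 * of_real pi * of_rat d * w) / (1 - epow (of_nat l) w)) z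
    = fact n * of_nat l ^ n * (epow d z * fps_nth (lerch_fps (epow (of_nat l) z) (of_rat d / of_nat l)) (Suc n)
        - epow (- d) z * fps_nth (lerch_fps (epow (of_nat l) z) (- (of_rat d / of_nat l))) (Suc n))"
proof -
  define \<kappa> where "\<kappa> = 2 * complex_of_real pi * \<i>"
  define w where "w = epow (of_nat l) z"
  define a where "a = complex_of_rat d / of_nat l"
  have \<kappa>0: "\<kappa> \<noteq> 0" by (simp add: \<kappa>_def)
  have la: "of_nat l * a = of_rat d" using l by (simp add: a_def)
  define H\<^sub>0 where "H\<^sub>0 = (fps_const (epow d z) * fps_exp a - fps_const (epow (- d) z) * fps_exp (- a))
      * inverse (1 - fps_const w * fps_exp 1)"
  define H where "H = (fps_const (epow d z) * fps_exp (\<kappa> * of_rat d) - fps_const (epow (- d) z) * fps_exp (- (\<kappa> * of_rat d)))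
      * inverse (1 - fps_const w * fps_exp (\<kappa> * of_nat l))"
  have w1: "fps_nth (1 - fps_const w * fps_exp 1) 0 \<noteq> (0 :: complex)"
    "fps_nth (1 - fps_const w * fps_exp (\<kappa> * of_nat l)) 0 \<noteq> 0" using w by (auto simp: w_def)
  have "(\<lambda>x. (epow d z * exp (\<kappa> * of_rat d * x) - epow (- d) z * exp (- (\<kappa> * of_rat d) * x))
      * inverse (1 - w * exp (\<kappa> * of_nat l * x))) has_fps_expansion H"
    unfolding H_def using w1 by (intro fps_expansion_intros) auto
  hence "(\<lambda>x. 1 / (2 * \<i>) * ((epow d z * exp (\<kappa> * of_rat d * x) - epow (- d) z * exp (- (\<kappa> * of_rat d) * x))
      * inverse (1 - w * exp (\<kappa> * of_nat l * x)))) has_fps_expansion (fps_const (1 / (2 * \<i>)) * H)"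
    by (rule has_fps_expansion_cmult_left)
  also have "(\<lambda>x. 1 / (2 * \<i>) * ((epow d z * exp (\<kappa> * of_rat d * x) - epow (- d) z * exp (- (\<kappa> * of_rat d) * x))
      * inverse (1 - w * exp (\<kappa> * of_nat l * x))))
    = (\<lambda>x. sin (2 * of_real pi * of_rat d * (z + x)) / (1 - epow (of_nat l) (z + x)))"
  proof
    fix x
    have e: "epow r z * exp (\<kappa> * of_rat r * x) = exp (\<i> * (2 * of_real pi * of_rat r * (z + x)))" for r
      by (simp add: epow_def \<kappa>_def exp_add[symmetric] algebra_simps)
    have e': "epow (- d) z * exp (- (\<kappa> * of_rat d) * x) = exp (- (\<i> * (2 * of_real pi * of_rat d * (z + x))))"
      using e[of "- d"] by (simp add: of_rat_minus)
    have e'': "w * exp (\<kappa> * of_nat l * x) = epow (of_nat l) (z + x)"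
      using e[of "of_nat l"] by (simp add: w_def epow_def mult_ac)
    show "1 / (2 * \<i>) * ((epow d z * exp (\<kappa> * of_rat d * x) - epow (- d) z * exp (- (\<kappa> * of_rat d) * x))
      * inverse (1 - w * exp (\<kappa> * of_nat l * x))) = sin (2 * of_real pi * of_rat d * (z + x)) / (1 - epow (of_nat l) (z + x))"
      unfolding e[of d] e' e'' sin_exp_eq divide_inverse by (simp only: mult_1_left mult_ac)
  qed
  finally have "(Dz ^^ n) (\<lambda>w. sin (2 * of_real pi * of_rat d * w) / (1 - epow (of_nat l) w)) z
      = (1 / \<kappa>) ^ n * (fact n * fps_nth (fps_const (1 / (2 * \<i>)) * H) n)"
    unfolding \<kappa>_def by (rule Dz_funpow_eq_fps_nth)
  hence "2 * \<i> * (Dz ^^ n) (\<lambda>w. sin (2 * of_real pi * of_rat d * w) / (1 - epow (of_nat l) w)) z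
      = (2 * \<i> * (1 / (2 * \<i>))) * ((1 / \<kappa>) ^ n * (fact n * fps_nth H n))"
    unfolding fps_mult_left_const_nth by (simp only: mult_ac)
  also have "2 * \<i> * (1 / (2 * \<i>)) = 1" by simp
  also have "1 * ((1 / \<kappa>) ^ n * (fact n * fps_nth H n)) = (1 / \<kappa>) ^ n * (fact n * fps_nth H n)"
    by (rule mult_1_left)
  also have "H = H\<^sub>0 oo (fps_const (\<kappa> * of_nat l) * fps_X)"
  proof -
    have "(fps_const (\<kappa> * of_nat l) * fps_X) $ 0 = (0 :: complex)" by simp
    thus ?thesis using w1 unfolding H_def H\<^sub>0_def
      by (simp add: fps_compose_mult_distrib fps_compose_sub_distrib fps_inverse_compose
            fps_exp_compose_linear la mult.assoc del: fps_const_mult)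
  qed
  also have "fps_nth (H\<^sub>0 oo (fps_const (\<kappa> * of_nat l) * fps_X)) n = (\<kappa> * of_nat l) ^ n * fps_nth H\<^sub>0 n"
    by (simp add: fps_compose_linear)
  also have "fps_nth H\<^sub>0 n = fps_nth (fps_X * H\<^sub>0) (Suc n)" by simp
  also have "fps_X * H\<^sub>0 = fps_const (epow d z) * lerch_fps w a - fps_const (epow (- d) z) * lerch_fps w (- a)"
    unfolding H\<^sub>0_def lerch_fps_def by (simp add: algebra_simps)
  finally show ?thesis using \<kappa>0 by (simp add: a_def w_def power_mult_distrib power_divide)
qed

section \<open>Asymptotics of the partial theta function\<close>

lemma of_real_of_rat [simp]: "complex_of_real (of_rat q) = of_rat q"
  by (induction q) (simp add: of_rat_rat)

lemma F_eq_shifted_gauss_sum: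
  assumes l: "l \<ge> 1" and t: "t > 0"
  shows "F d l z (\<i> * of_real t)
    = epow d z * shifted_gauss_sum (epow (of_nat l) z) (of_rat d / real l) (2 * pi * (real l)\<^sup>2 * t)"
proof -
  have summand: "epow (of_nat l * of_nat n + d) z * epow ((of_nat l * of_nat n + d)\<^sup>2) (\<i> * of_real t)
      = epow d z * (epow (of_nat l) z ^ n * of_real (exp (- (2 * pi * (real l)\<^sup>2 * t) * (real n + of_rat d / real l)\<^sup>2)))" for n
  proof -
    define Q where "Q = real l * real n + of_rat d"
    have "epow (of_nat l * of_nat n + d) z = epow d z * epow (of_nat l) z ^ n"
      by (simp add: epow_def of_rat_add of_rat_mult exp_add[symmetric] exp_of_nat_mult[symmetric] algebra_simps)
    moreover have "epow ((of_nat l * of_nat n + d)\<^sup>2) (\<i> * of_real t) = exp (of_real (- (2 * pi * t * Q\<^sup>2)))"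
      by (simp add: epow_def Q_def of_rat_add of_rat_mult of_rat_power mult_ac)
    moreover have "2 * pi * t * Q\<^sup>2 = 2 * pi * (real l)\<^sup>2 * t * (real n + of_rat d / real l)\<^sup>2"
    proof -
      have "Q = real l * (real n + of_rat d / real l)" using l by (simp add: Q_def distrib_left)
      thus ?thesis by (simp add: power_mult_distrib)
    qed
    ultimately show ?thesis by (simp flip: exp_of_real)
  qed
  have "epow (of_nat l) z \<noteq> 0" by (simp add: epow_def)
  moreover have "2 * pi * (real l)\<^sup>2 * t > 0" using l t by simp
  ultimately show ?thesis
    unfolding F_def shifted_gauss_sum_def summand by (intro suminf_mult summable_shifted_gauss)
qed

text \<open>Transfers estimates in s = 2 pi l^2 t to t; restricting to t < 1 / (2 pi l^2) keeps s in
  the range where they hold.\<close>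

lemma G_bigo:
  fixes X\<^sub>1 X\<^sub>2 M :: "real \<Rightarrow> complex"
  assumes l: "l \<ge> 1"
    and X1: "\<And>s. 0 < s \<Longrightarrow> s \<le> 1 \<Longrightarrow> norm (shifted_gauss_sum (epow (of_nat l) z) (of_rat d / real l) s - X\<^sub>1 s) \<le> C\<^sub>1 * s ^ (N + 1)"
    and X2: "\<And>s. 0 < s \<Longrightarrow> s \<le> 1 \<Longrightarrow> norm (shifted_gauss_sum (epow (of_nat l) z) (- (of_rat d / real l)) s - X\<^sub>2 s) \<le> C\<^sub>2 * s ^ (N + 1)"
    and M: "\<And>t. t > 0 \<Longrightarrow> M t = epow d z * X\<^sub>1 (2 * pi * (real l)\<^sup>2 * t) - epow (- d) z * X\<^sub>2 (2 * pi * (real l)\<^sup>2 * t)"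
  shows "(\<lambda>t. G d l z (\<i> * of_real t) - M t) \<in> O[at_right 0](\<lambda>t. of_real t ^ (N + 1))"
proof -
  define p where "p = 2 * pi * (real l)\<^sup>2"
  have p: "p > 0" using l by (simp add: p_def)
  define D where "D = norm (epow d z) * C\<^sub>1 + norm (epow (- d) z) * C\<^sub>2"
  show ?thesis
  proof (rule bigoI[where c = "D * p ^ (N + 1)"])
    have "eventually (\<lambda>t. t \<in> {0<..<1 / p}) (at_right 0)"
      using p by (intro eventually_at_right_real) auto
    thus "\<forall>\<^sub>F t in at_right 0. norm (G d l z (\<i> * of_real t) - M t) \<le> D * p ^ (N + 1) * norm (complex_of_real t ^ (N + 1))"
    proof eventually_elim
      case (elim t)
      hence t: "t > 0" "0 < p * t" "p * t \<le> 1" using p by (auto simp: field_simps)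
      have "G d l z (\<i> * of_real t) - M t
          = epow d z * (shifted_gauss_sum (epow (of_nat l) z) (of_rat d / real l) (p * t) - X\<^sub>1 (p * t))
          - epow (- d) z * (shifted_gauss_sum (epow (of_nat l) z) (- (of_rat d / real l)) (p * t) - X\<^sub>2 (p * t))"
        unfolding G_def M[OF t(1)] F_eq_shifted_gauss_sum[OF l t(1)] p_def
        by (simp add: of_rat_minus algebra_simps)
      hence "norm (G d l z (\<i> * of_real t) - M t)
          \<le> norm (epow d z) * norm (shifted_gauss_sum (epow (of_nat l) z) (of_rat d / real l) (p * t) - X\<^sub>1 (p * t))
          + norm (epow (- d) z) * norm (shifted_gauss_sum (epow (of_nat l) z) (- (of_rat d / real l)) (p * t) - X\<^sub>2 (p * t))"
        by (simp only: flip: norm_mult) (rule norm_triangle_ineq4)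
      also have "\<dots> \<le> norm (epow d z) * (C\<^sub>1 * (p * t) ^ (N + 1)) + norm (epow (- d) z) * (C\<^sub>2 * (p * t) ^ (N + 1))"
        by (intro add_mono mult_left_mono X1 X2 t) auto
      also have "\<dots> = D * p ^ (N + 1) * norm (complex_of_real t ^ (N + 1))"
        using t unfolding D_def norm_power norm_of_real power_mult_distrib by (simp add: algebra_simps)
      finally show ?case .
    qed
  qed
qed

lemma epow_eq_1_iff:
  assumes "l \<ge> 1"
  shows "epow (of_nat l) z = 1 \<longleftrightarrow> z \<in> frac_ints l"
proof -
  have "epow (of_nat l) z = 1 \<longleftrightarrow> (\<exists>n::int. of_nat l * z = of_int n)"
  proof
    assume "epow (of_nat l) z = 1"
    then obtain n where "Re (2 * of_real pi * \<i> * of_nat l * z) = 0" "Im (2 * of_real pi * \<i> * of_nat l * z) = of_int (2 * n) * pi"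
      unfolding epow_def exp_eq_1 by auto
    hence "of_nat l * z = of_int n" by (auto simp: complex_eq_iff)
    thus "\<exists>n::int. of_nat l * z = of_int n" ..
  next
    assume "\<exists>n::int. of_nat l * z = of_int n"
    then obtain n :: int where "of_nat l * z = of_int n" ..
    hence "epow (of_nat l) z = exp (2 * of_real pi * \<i> * of_int n)" by (simp add: epow_def mult.assoc)
    also have "\<dots> = 1" unfolding exp_eq_1 by auto
    finally show "epow (of_nat l) z = 1" .
  qed
  also have "\<dots> \<longleftrightarrow> z \<in> frac_ints l"
    using assms by (auto simp: frac_ints_def field_simps)
  finally show ?thesis .
qed

lemma norm_epow: "norm (epow (of_nat l) z) = exp (- (2 * pi * real l * Im z))"
  by (simp add: epow_def norm_exp_eq_Re)

lemma bernoulli_poly_0: "bernoulli_poly 0 x = 1"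
proof -
  have "fps_nth (Abs_fps (\<lambda>n. bernoulli_poly n x / fact n) * (fps_exp 1 - 1)) 1 = 1"
    unfolding bernoulli_poly_genfun by simp
  thus ?thesis by (simp add: fps_mult_nth)
qed

text \<open>The l^(2k) produced by the derivative is the one inside (-s)^k = (-2 pi t)^k l^(2k), and
  its (2k)! is the one in the even derivatives of the Gaussian at 0.\<close>

lemma sin_quotient_expansion:
  fixes d :: rat and l N :: nat and z :: complex and t :: real
  assumes l: "l \<ge> 1" and w: "epow (of_nat l) z \<noteq> 1"
  defines "a \<equiv> of_rat d / real l" and "s \<equiv> 2 * pi * (real l)\<^sup>2 * t"
  shows "2 * \<i> * (\<Sum>k=0..N.
      (Dz ^^ (2 * k)) (\<lambda>w. sin (2 * of_real pi * of_rat d * w) / (1 - epow (of_nat l) w)) z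
        * ((- 2 * of_real pi * of_real t) ^ k / fact k))
    = epow d z * (\<Sum>k=0..N. fps_nth (lerch_fps (epow (of_nat l) z) (of_real a)) (2 * k + 1) * of_real ((- s) ^ k * fact (2 * k) / fact k))
      - epow (- d) z * (\<Sum>k=0..N. fps_nth (lerch_fps (epow (of_nat l) z) (of_real (- a))) (2 * k + 1) * of_real ((- s) ^ k * fact (2 * k) / fact k))"
proof -
  define h where "h = (\<lambda>w. sin (2 * of_real pi * of_rat d * w) / (1 - epow (of_nat l) w))"
  define b where "b = (\<lambda>k. epow d z * fps_nth (lerch_fps (epow (of_nat l) z) (of_real a)) (2 * k + 1)
      - epow (- d) z * fps_nth (lerch_fps (epow (of_nat l) z) (of_real (- a))) (2 * k + 1))"
  have "2 * \<i> * ((Dz ^^ (2 * k)) h z * ((- 2 * of_real pi * of_real t) ^ k / fact k))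
      = b k * of_real ((- s) ^ k * fact (2 * k) / fact k)" for k
  proof -
    have "2 * \<i> * (Dz ^^ (2 * k)) h z = fact (2 * k) * of_nat l ^ (2 * k) * b k"
      using Dz_funpow_sin_quotient[OF l w, of "2 * k" d] by (simp add: h_def b_def a_def)
    moreover have "complex_of_real ((- s) ^ k) = (- 2 * of_real pi * of_real t) ^ k * of_nat l ^ (2 * k)"
    proof -
      have "complex_of_real (- s) = (- 2 * of_real pi * of_real t) * (of_nat l)\<^sup>2" by (simp add: s_def)
      thus ?thesis unfolding of_real_power by (simp only: power_mult_distrib power_mult)
    qed
    ultimately show ?thesis by (simp add: mult.assoc[symmetric])
  qed
  hence "2 * \<i> * (\<Sum>k=0..N. (Dz ^^ (2 * k)) h z * ((- 2 * of_real pi * of_real t) ^ k / fact k))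
      = (\<Sum>k=0..N. b k * of_real ((- s) ^ k * fact (2 * k) / fact k))"
    unfolding sum_distrib_left by simp
  also have "\<dots> = epow d z * (\<Sum>k=0..N. fps_nth (lerch_fps (epow (of_nat l) z) (of_real a)) (2 * k + 1) * of_real ((- s) ^ k * fact (2 * k) / fact k))
      - epow (- d) z * (\<Sum>k=0..N. fps_nth (lerch_fps (epow (of_nat l) z) (of_real (- a))) (2 * k + 1) * of_real ((- s) ^ k * fact (2 * k) / fact k))"
    unfolding b_def left_diff_distrib sum_subtractf sum_distrib_left by (simp only: mult.assoc)
  finally show ?thesis unfolding h_def .
qed

text \<open>Treats the open upper half-plane and the real points off (1/l) \<int> together; w
  \<noteq> 1 removes the s^(-1/2) term through the vanishing constant coefficient of
  \<open>lerch_fps\<close>.\<close>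

lemma G_asymp_unit_disc:
  fixes d :: rat and l N :: nat and z :: complex
  assumes l: "l \<ge> 1" and w: "epow (of_nat l) z \<noteq> 1" "norm (epow (of_nat l) z) \<le> 1"
  shows "(\<lambda>t::real. G d l z (\<i> * of_real t)
      - 2 * \<i> * (\<Sum>k=0..N.
          (Dz ^^ (2 * k)) (\<lambda>w. sin (2 * of_real pi * of_rat d * w) / (1 - epow (of_nat l) w)) z
            * ((- 2 * of_real pi * of_real t) ^ k / fact k)))
     \<in> O[at_right 0](\<lambda>t. of_real t ^ (N + 1))"
proof -
  have asymp: "\<exists>C. \<forall>s. 0 < s \<longrightarrow> s \<le> 1 \<longrightarrow> norm (shifted_gauss_sum (epow (of_nat l) z) a s
      - (\<Sum>k=0..N. fps_nth (lerch_fps (epow (of_nat l) z) (of_real a)) (2 * k + 1) * of_real ((- s) ^ k * fact (2 * k) / fact k)))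
        \<le> C * s ^ (N + 1)" for a
    by (rule shifted_gauss_sum_asymp[OF lerch_fps_mult[OF w(1), of "of_real a"] w(2), of N])
       (simp only: lerch_fps_nth_0 minus_zero mult_zero_left add_0, blast)
  obtain C\<^sub>1 where C1: "\<And>s. 0 < s \<Longrightarrow> s \<le> 1 \<Longrightarrow> norm (shifted_gauss_sum (epow (of_nat l) z) (of_rat d / real l) s
      - (\<Sum>k=0..N. fps_nth (lerch_fps (epow (of_nat l) z) (of_real (of_rat d / real l))) (2 * k + 1) * of_real ((- s) ^ k * fact (2 * k) / fact k)))
        \<le> C\<^sub>1 * s ^ (N + 1)" using asymp by blast
  obtain C\<^sub>2 where C2: "\<And>s. 0 < s \<Longrightarrow> s \<le> 1 \<Longrightarrow> norm (shifted_gauss_sum (epow (of_nat l) z) (- (of_rat d / real l)) s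
      - (\<Sum>k=0..N. fps_nth (lerch_fps (epow (of_nat l) z) (of_real (- (of_rat d / real l)))) (2 * k + 1) * of_real ((- s) ^ k * fact (2 * k) / fact k)))
        \<le> C\<^sub>2 * s ^ (N + 1)" using asymp by blast
  show ?thesis
    by (rule G_bigo[OF l C1 C2]) (use sin_quotient_expansion[OF l w(1)] in \<open>assumption | simp only:\<close>)+
qed

text \<open>The Poisson-dual terms: the frequency \<open>m = j - n\<close> contributes \<open>e\<^bsup>-\<pi>(z\<^sub>0 + n)\<^sup>2 / 2l\<^sup>2t\<^esup>\<close>.\<close>

lemma G_asymp_lower_half_plane:
  fixes d :: rat and l :: nat and z z0 :: complex and x0 y0 :: real and j :: int and N :: nat
  assumes l: "l \<ge> 1"
    and z: "z = (z0 + of_int j) / of_nat l"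
    and z0: "z0 = of_real x0 + \<i> * of_real y0"
    and Im: "Im z < 0"
  shows "(\<lambda>t::real. G d l z (\<i> * of_real t)
          - (2 * \<i> * of_real ((2 * (real l)\<^sup>2 * t) powr (- 1 / 2))
               * exp (- (of_real pi * z0\<^sup>2) / (2 * (of_nat l)\<^sup>2 * of_real t))
               * (\<Sum>n | \<bar>real_of_int n + x0\<bar> \<le> \<bar>y0\<bar>.
                    exp (- (of_real pi * (of_int n)\<^sup>2) / (2 * (of_nat l)\<^sup>2 * of_real t)
                         - of_real pi * z0 * of_int n / ((of_nat l)\<^sup>2 * of_real t))
                      * sin (2 * of_real pi * of_rat d / of_nat l * of_int (j - n)))
             + 2 * \<i> * (\<Sum>a=0..N.
                 (Dz ^^ (2 * a)) (\<lambda>w. sin (2 * of_real pi * of_rat d * w) / (1 - epow (of_nat l) w)) z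
                   * ((- 2 * of_real pi * of_real t) ^ a / fact a))))
         \<in> O[at_right 0](\<lambda>t. of_real t ^ (N + 1))"
proof -
  define \<zeta> where "\<zeta> = of_nat l * z"
  have \<zeta>: "\<zeta> = z0 + of_int j" using l by (simp add: \<zeta>_def z)
  have wexp: "epow (of_nat l) z = exp (2 * of_real pi * \<i> * \<zeta>)" by (simp add: epow_def \<zeta>_def mult.assoc)
  have wn: "norm (epow (of_nat l) z) > 1" unfolding norm_epow using l Im by (simp add: mult_pos_neg)
  hence w1: "epow (of_nat l) z \<noteq> 1" by auto
  define A where "A = {m. \<bar>real_of_int m - Re \<zeta>\<bar> \<le> \<bar>Im \<zeta>\<bar>}"
  define X where "X = (\<lambda>a s. exp (- (2 * of_real pi * \<i> * \<zeta> * of_real a)) *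
         (\<Sum>m\<in>A. of_real (sqrt (pi / s)) *
            exp (2 * of_real pi * \<i> * of_int m * of_real a - of_real (pi\<^sup>2) * (\<zeta> - of_int m)\<^sup>2 / of_real s))
       + (\<Sum>k=0..N. fps_nth (lerch_fps (epow (of_nat l) z) (of_real a)) (2 * k + 1) * complex_of_real ((- s) ^ k * fact (2 * k) / fact k)))"
  have asymp: "\<exists>C. \<forall>s. 0 < s \<longrightarrow> s \<le> 1 \<longrightarrow> norm (shifted_gauss_sum (epow (of_nat l) z) a s - X a s) \<le> C * s ^ (N + 1)" for a
    unfolding X_def A_def wexp
    by (rule shifted_gauss_sum_asymp_large[of "lerch_fps (epow (of_nat l) z) (of_real a)" \<zeta> a N])
       (use lerch_fps_mult[OF w1] wn in \<open>auto simp: wexp\<close>)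
  obtain C\<^sub>1 where C1: "\<And>s. 0 < s \<Longrightarrow> s \<le> 1 \<Longrightarrow> norm (shifted_gauss_sum (epow (of_nat l) z) (of_rat d / real l) s
      - X (of_rat d / real l) s) \<le> C\<^sub>1 * s ^ (N + 1)" using asymp by blast
  obtain C\<^sub>2 where C2: "\<And>s. 0 < s \<Longrightarrow> s \<le> 1 \<Longrightarrow> norm (shifted_gauss_sum (epow (of_nat l) z) (- (of_rat d / real l)) s
      - X (- (of_rat d / real l)) s) \<le> C\<^sub>2 * s ^ (N + 1)" using asymp by blast
  show ?thesis
  proof (rule G_bigo[OF l C1 C2])
    fix t :: real assume t: "t > 0"
    define s where "s = 2 * pi * (real l)\<^sup>2 * t"
    define a where "a = of_rat d / real l"
    define r where "r = (2 * (real l)\<^sup>2 * t) powr (- 1 / 2)"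
    define Q where "Q = (\<lambda>n. exp (- (of_real pi * (z0 + of_int n)\<^sup>2) / (2 * (of_nat l)\<^sup>2 * of_real t)))"
    have r: "sqrt (pi / s) = r"
    proof -
      have "pi / s = inverse (2 * (real l)\<^sup>2 * t)" by (simp add: s_def divide_simps)
      thus ?thesis unfolding r_def using l t by (simp only: real_sqrt_inverse) (simp add: real_sqrt_inverse powr_minus powr_half_sqrt)
    qed
    \<comment> \<open>With a = d / l and \<open>\<zeta>\<close> standing here for l z, the prefactor
      from Poisson summation is inverse to \<open>epow d z\<close>, so the dual terms for d and -d
      differ only in their phases.\<close>
    have cancel: "epow d z * exp (- (2 * of_real pi * \<i> * \<zeta> * of_real a)) = 1"
      "epow (- d) z * exp (- (2 * of_real pi * \<i> * \<zeta> * of_real (- a))) = 1"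
      using l by (simp_all add: epow_def \<zeta>_def a_def of_rat_minus flip: exp_add)
    \<comment> \<open>Here Re \<zeta> = x0 + j, so m - Re \<zeta> = -(n + x0) for m = j - n.\<close>
    have bij: "bij_betw (\<lambda>n. j - n) {n. \<bar>real_of_int n + x0\<bar> \<le> \<bar>y0\<bar>} A"
      by (rule bij_betw_byWitness[where f' = "\<lambda>m. j - m"]) (auto simp: A_def \<zeta> z0)
    have quad: "of_real (pi\<^sup>2) * (\<zeta> - of_int (j - n))\<^sup>2 / of_real s = of_real pi * (z0 + of_int n)\<^sup>2 / (2 * (of_nat l)\<^sup>2 * of_real t)" for n
      by (simp add: \<zeta> s_def power2_eq_square)
    have Q_exp: "exp (E - of_real pi * (z0 + of_int n)\<^sup>2 / (2 * (of_nat l)\<^sup>2 * of_real t)) = Q n * exp E" for n E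
      unfolding Q_def exp_add[symmetric] by (rule arg_cong[of _ _ exp]) simp
    have dual: "(\<Sum>m\<in>A. of_real (sqrt (pi / s)) *
            exp (2 * of_real pi * \<i> * of_int m * of_real a' - of_real (pi\<^sup>2) * (\<zeta> - of_int m)\<^sup>2 / of_real s))
        = of_real r * (\<Sum>n | \<bar>real_of_int n + x0\<bar> \<le> \<bar>y0\<bar>. Q n * exp (2 * of_real pi * \<i> * of_int (j - n) * of_real a'))" for a'
      unfolding sum.reindex_bij_betw[OF bij, symmetric] quad r sum_distrib_left Q_exp ..
    have sin: "exp (2 * of_real pi * \<i> * of_int m * of_real a) - exp (2 * of_real pi * \<i> * of_int m * of_real (- a))
        = 2 * \<i> * sin (2 * of_real pi * of_rat d / of_nat l * of_int m)" for m
    proof -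
      have "2 * of_real pi * \<i> * of_int m * of_real a = \<i> * (2 * of_real pi * of_rat d / of_nat l * of_int m)"
        by (simp add: a_def)
      moreover have "2 * of_real pi * \<i> * of_int m * of_real (- a) = - (\<i> * (2 * of_real pi * of_rat d / of_nat l * of_int m))"
        by (simp add: a_def)
      ultimately show ?thesis unfolding sin_exp_eq by (simp only:) simp
    qed
    have Q: "exp (- (of_real pi * z0\<^sup>2) / (2 * (of_nat l)\<^sup>2 * of_real t)) *
        exp (- (of_real pi * (of_int n)\<^sup>2) / (2 * (of_nat l)\<^sup>2 * of_real t)
              - of_real pi * z0 * of_int n / ((of_nat l)\<^sup>2 * of_real t)) = Q n" for n
      unfolding Q_def exp_add[symmetric]
      by (rule arg_cong[of _ _ exp]) (use l t in \<open>simp add: power2_eq_square field_simps\<close>)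
    have "2 * \<i> * of_real r * exp (- (of_real pi * z0\<^sup>2) / (2 * (of_nat l)\<^sup>2 * of_real t))
         * (\<Sum>n | \<bar>real_of_int n + x0\<bar> \<le> \<bar>y0\<bar>.
              exp (- (of_real pi * (of_int n)\<^sup>2) / (2 * (of_nat l)\<^sup>2 * of_real t)
                   - of_real pi * z0 * of_int n / ((of_nat l)\<^sup>2 * of_real t))
                * sin (2 * of_real pi * of_rat d / of_nat l * of_int (j - n)))
       = of_real r * (\<Sum>n | \<bar>real_of_int n + x0\<bar> \<le> \<bar>y0\<bar>. Q n * (2 * \<i> * sin (2 * of_real pi * of_rat d / of_nat l * of_int (j - n))))"
      unfolding Q[symmetric] sum_distrib_left by (simp only: mult_ac)
    also have "\<dots> = of_real r * (\<Sum>n | \<bar>real_of_int n + x0\<bar> \<le> \<bar>y0\<bar>. Q n * exp (2 * of_real pi * \<i> * of_int (j - n) * of_real a))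
        - of_real r * (\<Sum>n | \<bar>real_of_int n + x0\<bar> \<le> \<bar>y0\<bar>. Q n * exp (2 * of_real pi * \<i> * of_int (j - n) * of_real (- a)))"
      unfolding sin[symmetric] right_diff_distrib sum_subtractf ..
    finally have main: "2 * \<i> * of_real r * exp (- (of_real pi * z0\<^sup>2) / (2 * (of_nat l)\<^sup>2 * of_real t))
         * (\<Sum>n | \<bar>real_of_int n + x0\<bar> \<le> \<bar>y0\<bar>.
              exp (- (of_real pi * (of_int n)\<^sup>2) / (2 * (of_nat l)\<^sup>2 * of_real t)
                   - of_real pi * z0 * of_int n / ((of_nat l)\<^sup>2 * of_real t))
                * sin (2 * of_real pi * of_rat d / of_nat l * of_int (j - n)))
       = of_real r * (\<Sum>n | \<bar>real_of_int n + x0\<bar> \<le> \<bar>y0\<bar>. Q n * exp (2 * of_real pi * \<i> * of_int (j - n) * of_real a))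
        - of_real r * (\<Sum>n | \<bar>real_of_int n + x0\<bar> \<le> \<bar>y0\<bar>. Q n * exp (2 * of_real pi * \<i> * of_int (j - n) * of_real (- a)))" .
    have alg: "u * (e * T + P) - u' * (e' * T' + P') = (T - T') + (u * P - u' * P')"
      if "u * e = 1" "u' * e' = 1" for u u' e e' T T' P P' :: complex
    proof -
      have "u * (e * T + P) - u' * (e' * T' + P') = (u * e) * T - (u' * e') * T' + (u * P - u' * P')"
        by (simp add: algebra_simps)
      thus ?thesis by (simp add: that)
    qed
    show "2 * \<i> * of_real ((2 * (real l)\<^sup>2 * t) powr (- 1 / 2))
               * exp (- (of_real pi * z0\<^sup>2) / (2 * (of_nat l)\<^sup>2 * of_real t))
               * (\<Sum>n | \<bar>real_of_int n + x0\<bar> \<le> \<bar>y0\<bar>.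
                    exp (- (of_real pi * (of_int n)\<^sup>2) / (2 * (of_nat l)\<^sup>2 * of_real t)
                         - of_real pi * z0 * of_int n / ((of_nat l)\<^sup>2 * of_real t))
                      * sin (2 * of_real pi * of_rat d / of_nat l * of_int (j - n)))
             + 2 * \<i> * (\<Sum>a=0..N.
                 (Dz ^^ (2 * a)) (\<lambda>w. sin (2 * of_real pi * of_rat d * w) / (1 - epow (of_nat l) w)) z
                   * ((- 2 * of_real pi * of_real t) ^ a / fact a))
          = epow d z * X (of_rat d / real l) (2 * pi * (real l)\<^sup>2 * t)
            - epow (- d) z * X (- (of_rat d / real l)) (2 * pi * (real l)\<^sup>2 * t)"
      unfolding sin_quotient_expansion[OF l w1] r_def[symmetric] main
      unfolding a_def[symmetric] s_def[symmetric] X_def dual alg[OF cancel] ..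
  qed
qed

text \<open>Here w = 1, and 1 - e^X = -(e^X - 1) gives the Bernoulli generating series with the
  opposite sign. Its constant coefficient -1 meets the primitive of the Gaussian at 0 and yields the
  term of order t^(-1/2).\<close>

lemma G_asymp_frac_ints:
  fixes d :: rat and l N :: nat and z :: complex
  assumes l: "l \<ge> 1" and z: "z \<in> frac_ints l"
  shows "(\<lambda>t::real. G d l z (\<i> * of_real t)
          - (\<i> * sin (2 * of_real pi * of_rat d * z) / (of_nat l * of_real ((2 * t) powr (1 / 2)))
             - (\<Sum>a=0..N.
                 (epow d z * bernoulli_poly (2 * a + 1) (of_rat d / of_nat l)
                   - epow (- d) z * bernoulli_poly (2 * a + 1) (- (of_rat d / of_nat l)))
                 * ((- 2 * of_real pi * (of_nat l)\<^sup>2 * of_real t) ^ a / (fact a * of_nat (2 * a + 1))))))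
         \<in> O[at_right 0](\<lambda>t. of_real t ^ (N + 1))"
proof -
  have w: "epow (of_nat l) z = 1" using epow_eq_1_iff[OF l] z by simp
  define b where "b = (\<lambda>a. - Abs_fps (\<lambda>n. bernoulli_poly n a / fact n))"
  have b: "b a * (1 - fps_const 1 * fps_exp 1) = fps_X * fps_exp a" for a
    using bernoulli_poly_genfun[of a] by (simp add: b_def algebra_simps)
  define X where "X = (\<lambda>a s. of_real (sqrt pi / (2 * sqrt s))
      - (\<Sum>k=0..N. bernoulli_poly (2 * k + 1) (of_real a) * (complex_of_real (- s) ^ k / (fact k * of_nat (2 * k + 1)))))"
  have X: "- fps_nth (b (of_real a)) 0 * of_real (sqrt pi / (2 * sqrt s))
       + (\<Sum>k=0..N. fps_nth (b (of_real a)) (2 * k + 1) * of_real ((- s) ^ k * fact (2 * k) / fact k)) = X a s" for a s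
  proof -
    have summand: "fps_nth (b (of_real a)) (2 * k + 1) * of_real ((- s) ^ k * fact (2 * k) / fact k)
        = - (bernoulli_poly (2 * k + 1) (of_real a) * (complex_of_real (- s) ^ k / (fact k * of_nat (2 * k + 1))))" for k
    proof -
      \<comment> \<open>The (2k)! of the Gaussian derivative against the (2k + 1)! of the generating
        series leaves 1 / (2k + 1).\<close>
      have "fact (2 * k + 1) = (of_nat (2 * k + 1) * fact (2 * k) :: complex)" by simp
      moreover have "of_nat (2 * k + 1) \<noteq> (0 :: complex)" by (simp only: of_nat_eq_0_iff)
      ultimately show ?thesis by (simp add: b_def del: of_nat_add of_nat_Suc fact_Suc of_nat_mult)
    qed
    show ?thesis unfolding X_def summand sum_negf by (simp add: b_def bernoulli_poly_0)
  qed
  have asymp: "\<exists>C. \<forall>s. 0 < s \<longrightarrow> s \<le> 1 \<longrightarrow> norm (shifted_gauss_sum (epow (of_nat l) z) a s - X a s) \<le> C * s ^ (N + 1)" for a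
    unfolding w X[symmetric]
    by (rule shifted_gauss_sum_asymp[OF b[of "of_real a"], of N]) (simp, blast)
  obtain C\<^sub>1 where C1: "\<And>s. 0 < s \<Longrightarrow> s \<le> 1 \<Longrightarrow> norm (shifted_gauss_sum (epow (of_nat l) z) (of_rat d / real l) s
      - X (of_rat d / real l) s) \<le> C\<^sub>1 * s ^ (N + 1)" using asymp by blast
  obtain C\<^sub>2 where C2: "\<And>s. 0 < s \<Longrightarrow> s \<le> 1 \<Longrightarrow> norm (shifted_gauss_sum (epow (of_nat l) z) (- (of_rat d / real l)) s
      - X (- (of_rat d / real l)) s) \<le> C\<^sub>2 * s ^ (N + 1)" using asymp by blast
  show ?thesis
  proof (rule G_bigo[OF l C1 C2])
    fix t :: real assume t: "t > 0"
    define s where "s = 2 * pi * (real l)\<^sup>2 * t"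
    have root: "sqrt pi / (2 * sqrt s) = 1 / (2 * (real l * (2 * t) powr (1 / 2)))"
    proof -
      have "sqrt s = sqrt pi * (real l * sqrt (2 * t))"
        by (simp add: s_def real_sqrt_mult)
      thus ?thesis using t by (simp add: powr_half_sqrt)
    qed
    have sin: "\<i> * sin (2 * of_real pi * of_rat d * z) = (epow d z - epow (- d) z) / 2"
      unfolding sin_exp_eq epow_def by (simp add: of_rat_minus mult_ac)
    have ms: "- 2 * of_real pi * (of_nat l)\<^sup>2 * of_real t = complex_of_real (- s)" by (simp add: s_def)
    show "\<i> * sin (2 * of_real pi * of_rat d * z) / (of_nat l * of_real ((2 * t) powr (1 / 2)))
             - (\<Sum>a=0..N.
                 (epow d z * bernoulli_poly (2 * a + 1) (of_rat d / of_nat l)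
                   - epow (- d) z * bernoulli_poly (2 * a + 1) (- (of_rat d / of_nat l)))
                 * ((- 2 * of_real pi * (of_nat l)\<^sup>2 * of_real t) ^ a / (fact a * of_nat (2 * a + 1))))
       = epow d z * X (of_rat d / real l) (2 * pi * (real l)\<^sup>2 * t) - epow (- d) z * X (- (of_rat d / real l)) (2 * pi * (real l)\<^sup>2 * t)"
    proof -
      define q where "q = (\<lambda>k. complex_of_real (- s) ^ k / (fact k * of_nat (2 * k + 1)))"
      define p where "p = complex_of_real (1 / (2 * (real l * (2 * t) powr (1 / 2))))"
      define B where "B = (\<lambda>x. \<Sum>k=0..N. bernoulli_poly (2 * k + 1) x * q k)"
      have X': "X a s = p - B (of_real a)" for a unfolding X_def root p_def B_def q_def ..
      have 1: "\<i> * sin (2 * of_real pi * of_rat d * z) / (of_nat l * of_real ((2 * t) powr (1 / 2)))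
          = epow d z * p - epow (- d) z * p"
        unfolding sin p_def by (simp add: diff_divide_distrib)
      have 2: "(\<Sum>a=0..N. (epow d z * bernoulli_poly (2 * a + 1) x - epow (- d) z * bernoulli_poly (2 * a + 1) (- x)) * q a)
          = epow d z * B x - epow (- d) z * B (- x)" for x
        unfolding B_def left_diff_distrib sum_subtractf sum_distrib_left by (simp only: mult.assoc)
      have "complex_of_real (of_rat d / real l) = of_rat d / of_nat l" by simp
      moreover have "complex_of_real (- s) ^ k / (fact k * of_nat (2 * k + 1)) = q k" for k
        unfolding q_def ..
      ultimately show ?thesis unfolding ms s_def[symmetric] X' 1
        by (simp only: 2 of_real_minus) (simp add: algebra_simps)
    qed
  qed
qed

theorem theorem5p1:
  fixes d :: rat and l :: nat and z z0 :: complex and x0 y0 :: real and j :: int and N :: nat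
  assumes l: "l \<ge> 1"
    and z: "z = (z0 + of_int j) / of_nat l"
    and z0: "z0 = of_real x0 + \<i> * of_real y0"
    and x0: "- 1 / 2 < x0" "x0 \<le> 1 / 2"
  shows
    "(Im z > 0 \<or> (Im z < 0 \<and> \<bar>x0\<bar> > \<bar>y0\<bar>) \<or> z \<in> \<real> - frac_ints l \<longrightarrow>
       (\<lambda>t::real. G d l z (\<i> * of_real t)
          - 2 * \<i> * (\<Sum>a=0..N.
              (Dz ^^ (2 * a)) (\<lambda>w. sin (2 * of_real pi * of_rat d * w) / (1 - epow (of_nat l) w)) z
                * ((- 2 * of_real pi * of_real t) ^ a / fact a)))
         \<in> O[at_right 0](\<lambda>t. of_real t ^ (N + 1)))
     \<and>
     (Im z < 0 \<and> \<bar>x0\<bar> \<le> \<bar>y0\<bar> \<longrightarrow>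
       (\<lambda>t::real. G d l z (\<i> * of_real t)
          - (2 * \<i> * of_real ((2 * (real l)\<^sup>2 * t) powr (- 1 / 2))
               * exp (- (of_real pi * z0\<^sup>2) / (2 * (of_nat l)\<^sup>2 * of_real t))
               * (\<Sum>n | \<bar>real_of_int n + x0\<bar> \<le> \<bar>y0\<bar>.
                    exp (- (of_real pi * (of_int n)\<^sup>2) / (2 * (of_nat l)\<^sup>2 * of_real t)
                         - of_real pi * z0 * of_int n / ((of_nat l)\<^sup>2 * of_real t))
                      * sin (2 * of_real pi * of_rat d / of_nat l * of_int (j - n)))
             + 2 * \<i> * (\<Sum>a=0..N.
                 (Dz ^^ (2 * a)) (\<lambda>w. sin (2 * of_real pi * of_rat d * w) / (1 - epow (of_nat l) w)) z
                   * ((- 2 * of_real pi * of_real t) ^ a / fact a))))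
         \<in> O[at_right 0](\<lambda>t. of_real t ^ (N + 1)))
     \<and>
     (z \<in> frac_ints l \<longrightarrow>
       (\<lambda>t::real. G d l z (\<i> * of_real t)
          - (\<i> * sin (2 * of_real pi * of_rat d * z) / (of_nat l * of_real ((2 * t) powr (1 / 2)))
             - (\<Sum>a=0..N.
                 (epow d z * bernoulli_poly (2 * a + 1) (of_rat d / of_nat l)
                   - epow (- d) z * bernoulli_poly (2 * a + 1) (- (of_rat d / of_nat l)))
                 * ((- 2 * of_real pi * (of_nat l)\<^sup>2 * of_real t) ^ a / (fact a * of_nat (2 * a + 1))))))
         \<in> O[at_right 0](\<lambda>t. of_real t ^ (N + 1)))"
proof (intro conjI impI)
  assume c: "Im z > 0 \<or> (Im z < 0 \<and> \<bar>x0\<bar> > \<bar>y0\<bar>) \<or> z \<in> \<real> - frac_ints l"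
  show "(\<lambda>t::real. G d l z (\<i> * of_real t)
          - 2 * \<i> * (\<Sum>a=0..N.
              (Dz ^^ (2 * a)) (\<lambda>w. sin (2 * of_real pi * of_rat d * w) / (1 - epow (of_nat l) w)) z
                * ((- 2 * of_real pi * of_real t) ^ a / fact a)))
         \<in> O[at_right 0](\<lambda>t. of_real t ^ (N + 1))"
  \<comment> \<open>The three alternatives are regrouped by |w|: Im z < 0 means |w| > 1, everything
    else |w| \<le> 1.\<close>
  proof (cases "Im z < 0")
    case True
    hence "\<bar>x0\<bar> > \<bar>y0\<bar>" using c by (auto simp: complex_is_Real_iff)
    \<comment> \<open>Lying in (-1/2, 1/2], x0 has the least absolute value among its integer
      translates; so no n satisfies |n + x0| \<le> |y0| and the exponential part disappears.\<close>
    moreover have "\<bar>x0\<bar> \<le> \<bar>real_of_int n + x0\<bar>" for n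
    proof (cases "n = 0")
      case False
      hence "\<bar>real_of_int n\<bar> \<ge> 1" by linarith
      thus ?thesis using x0 by linarith
    qed simp
    ultimately have empty: "{n. \<bar>real_of_int n + x0\<bar> \<le> \<bar>y0\<bar>} = {}"
      by (auto simp: not_le intro: less_le_trans)
    show ?thesis
      using G_asymp_lower_half_plane[OF l z z0 True, of d N] unfolding empty by simp
  next
    case False
    have "Im z = 0 \<Longrightarrow> z \<notin> frac_ints l" using c by auto
    moreover have "Im z \<noteq> 0 \<Longrightarrow> z \<notin> frac_ints l" by (auto simp: frac_ints_def)
    ultimately have "epow (of_nat l) z \<noteq> 1" using epow_eq_1_iff[OF l] by blast
    moreover have "norm (epow (of_nat l) z) \<le> 1" unfolding norm_epow using False by simp
    ultimately show ?thesis by (rule G_asymp_unit_disc[OF l])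
  qed
qed (use G_asymp_lower_half_plane[OF l z z0, of d N] G_asymp_frac_ints[OF l, of z d N] in blast)+

end
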